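(* There are absolute constants $c>0$ and $A>0$ such that the following holds. Let $q\in\mathbb N$, and suppose there is a real Dirichlet character $\chi_q$ modulo $q$ with $L(1-\delta_q,\chi_q)=0$ for some $0<\delta_q\le\frac{c}{\log q}$. Let $y\defeq\exp\big\{(\log q/\delta_q)^{1/2}\big\}$. Then $W_y\le A\,\delta_q\,y$.
   Context: For $y\ge2$, $W_y\defeq\min|[0,y]\cap\mathcal S_{(y/\log y)^{1/2}}|$, where $\mathcal S_z\defeq\mathbb Z\setminus\bigcup_{p\le z}\{n:n\equiv a_p\bmod p\}$ and the minimum is over all choices of residue classes $a_p\bmod p$ for primes $p\le(y/\log y)^{1/2}$. *)

theory Defs
  imports "HOL-Complex_Analysis.Complex_Analysis" "HOL-Number_Theory.Number_Theory"
begin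

subsection \<open>Dirichlet characters and their L-functions\<close>

definition dirichlet_character :: "nat \<Rightarrow> (int \<Rightarrow> complex) \<Rightarrow> bool" where
  "dirichlet_character q chi \<longleftrightarrow>
     q > 0 \<and>
     (\<forall>m n. chi (m * n) = chi m * chi n) \<and>
     (\<forall>n. chi (n + int q) = chi n) \<and>
     (\<forall>n. chi n \<noteq> 0 \<longleftrightarrow> coprime n (int q))"

definition real_character :: "(int \<Rightarrow> complex) \<Rightarrow> bool" where
  "real_character chi \<longleftrightarrow> (\<forall>n. chi n \<in> \<real>)"

definition principal_character :: "nat \<Rightarrow> (int \<Rightarrow> complex) \<Rightarrow> bool" where
  "principal_character q chi \<longleftrightarrow> (\<forall>n. coprime n (int q) \<longrightarrow> chi n = 1)"

definition dirichlet_L_series :: "(int \<Rightarrow> complex) \<Rightarrow> complex \<Rightarrow> complex" where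
  "dirichlet_L_series chi s = (\<Sum>n. chi (int (Suc n)) / of_nat (Suc n) powr s)"

definition dirichlet_L_domain :: "nat \<Rightarrow> (int \<Rightarrow> complex) \<Rightarrow> real \<Rightarrow> complex set" where
  "dirichlet_L_domain q chi \<sigma> =
     {s. Re s > \<sigma>} - (if principal_character q chi then {1} else {})"

text \<open>
  The value at \<open>s\<close> of the analytic continuation of the Dirichlet series from \<open>Re s > 1\<close>.
  The half-planes (punctured at the pole \<open>1\<close> in the principal case) are connected and nested,
  so all continuations of this kind agree at \<open>s\<close>; since \<open>\<sigma>\<close> is arbitrary, every point of the plane
  other than the pole is covered.  At the pole itself the value is unspecified.
\<close>
definition dirichlet_L :: "nat \<Rightarrow> (int \<Rightarrow> complex) \<Rightarrow> complex \<Rightarrow> complex" where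
  "dirichlet_L q chi s = (THE w. \<exists>\<sigma> f.
     s \<in> dirichlet_L_domain q chi \<sigma> \<and>
     f holomorphic_on dirichlet_L_domain q chi \<sigma> \<and>
     (\<forall>z. Re z > 1 \<longrightarrow> f z = dirichlet_L_series chi z) \<and>
     w = f s)"

lemma dirichlet_L_domain_open: "open (dirichlet_L_domain q chi \<sigma>)"
  by (auto simp: dirichlet_L_domain_def open_halfspace_Re_gt intro!: open_Diff)

lemma dirichlet_L_domain_connected: "connected (dirichlet_L_domain q chi \<sigma>)"
proof -
  have "connected {s. Re s > \<sigma>}"
    by (intro convex_connected convex_halfspace_Re_gt)
  moreover have "connected ({s. Re s > \<sigma>} - {1})"
    by (rule connected_open_delete)
       (use calculation in \<open>auto simp: open_halfspace_Re_gt\<close>)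
  ultimately show ?thesis by (auto simp: dirichlet_L_domain_def)
qed

lemma dirichlet_L_eqI:
  assumes s: "s \<in> dirichlet_L_domain q chi \<sigma>"
    and f: "f holomorphic_on dirichlet_L_domain q chi \<sigma>"
    and eq: "\<And>z. Re z > 1 \<Longrightarrow> f z = dirichlet_L_series chi z"
  shows "dirichlet_L q chi s = f s"
  unfolding dirichlet_L_def
proof (rule the_equality, goal_cases)
  case 1
  show ?case using assms by blast
next
  case (2 w)
  then obtain \<sigma>' g where g: "s \<in> dirichlet_L_domain q chi \<sigma>'"
      "g holomorphic_on dirichlet_L_domain q chi \<sigma>'"
      "\<And>z. Re z > 1 \<Longrightarrow> g z = dirichlet_L_series chi z" "w = g s"
    by blast
  define \<tau> where "\<tau> = max \<sigma> \<sigma>'"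
  let ?D = "dirichlet_L_domain q chi \<tau>"
  have D: "?D \<subseteq> dirichlet_L_domain q chi \<sigma>" "?D \<subseteq> dirichlet_L_domain q chi \<sigma>'" "s \<in> ?D"
    using s g(1) by (auto simp: \<tau>_def dirichlet_L_domain_def split: if_splits)
  let ?U = "{z. Re z > max \<tau> 1}"
  have U: "?U \<subseteq> ?D" "of_real (max \<tau> 1 + 1) \<in> ?U"
    by (auto simp: dirichlet_L_domain_def)
  have oU: "open ?U" by (rule open_halfspace_Re_gt)
  have "(\<lambda>z. g z - f z) s = 0"
  proof (rule analytic_continuation_open[where f = "\<lambda>z. g z - f z" and g = "\<lambda>_. 0"])
    show "open ?U" "?U \<subseteq> ?D" "?U \<noteq> {}" using U oU by blast+
    show "open ?D" "connected ?D"
      by (rule dirichlet_L_domain_open dirichlet_L_domain_connected)+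
    show "(\<lambda>z. g z - f z) holomorphic_on ?D"
      using D f g(2) by (intro holomorphic_intros) (auto elim: holomorphic_on_subset)
    show "g z - f z = 0" if "z \<in> ?U" for z using that eq g(3) by auto
  qed (use D in auto)
  then show ?case using g(4) by simp
qed


subsection \<open>Minimal sifted sets\<close>

definition sifted_set :: "real \<Rightarrow> (nat \<Rightarrow> int) \<Rightarrow> int set" where
  "sifted_set z a = UNIV - (\<Union>p\<in>{p. prime p \<and> real p \<le> z}. {n. [n = a p] (mod int p)})"

text \<open>The infimum is one of natural numbers over a nonempty set, hence an attained minimum.\<close>
definition W :: "real \<Rightarrow> nat" where
  "W y = (INF a. card ({n. 0 \<le> real_of_int n \<and> real_of_int n \<le> y} \<inter>
                         sifted_set (sqrt (y / ln y)) a))"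

end

theory Submission
  imports Defs
begin

text \<open>
  Write \<open>f\<close> for the character, \<open>\<lambda> = 1 * f \<ge> 0\<close> and \<open>\<beta> = 1 - \<delta>\<close>. Since \<open>L(\<beta>) = 0\<close>, the hyperbola
  method gives \<open>\<Sum>\<^sub>n\<^sub>\<le>\<^sub>N \<lambda>(n)/n \<ge> (2/3) L(1)/\<delta>\<close> for \<open>N = q^42\<close>, while comparison with a Lambert series gives
  \<open>\<Sum>\<^sub>n\<^sub>\<le>\<^sub>x \<lambda>(n) \<lless> L(1) x\<close>. If \<open>\<theta>\<^sub>+\<close> counts the primes with \<open>f(p) = 1\<close>, weighted by \<open>ln p\<close>, then
  \<open>\<Sum>\<^sub>m \<lambda>(m) \<theta>\<^sub>+(x/m) \<le> ln x \<Sum>\<^sub>n\<^sub>\<le>\<^sub>x \<lambda>(n)\<close>, so \<open>\<theta>\<^sub>+(t) \<lless> \<delta> t ln x\<close> at some scale \<open>t = x/m\<close> with \<open>m \<le> N\<close>.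

  Choose a multiple \<open>Q\<close> of \<open>q\<close> with \<open>Qy\<close> of order \<open>t\<close> and sieve \<open>n \<in> [0, y]\<close> by the primes not dividing \<open>Q\<close>
  so that \<open>Qn + a\<close> has no small prime factor, where \<open>f(a) = 1\<close>. A survivor \<open>Qn + a\<close> is \<open>1\<close>, a prime with
  \<open>f(p) = 1\<close>, or a product of two primes near \<open>sqrt y\<close>; by Chebyshev's bound the last kind is rare because
  \<open>\<delta> (ln y)^2 = ln q\<close>. Averaging over \<open>a\<close> replaces estimates in a single progression, and choosing
  the classes modulo the primes dividing \<open>Q\<close> greedily recovers the factor \<open>\<phi>(Q)/Q\<close>.
\<close>

subsection \<open>Real characters and their L-functions at real points\<close>

text \<open>The bound for primes with \<open>f p = 1\<close> holds only on average over
  \<open>m\<close>, so the sparse scale \<open>t\<close> is not at free disposal: it is known up to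
  a power of \<open>q\<close>, and \<open>Q\<close> has to be fitted to it afterwards.
  \<open>L 1\<close> enters both sides of the averaged inequality and cancels, so no precise value
  of it is required; the crude polynomial bounds \<open>L_1_ge\<close> and
  \<open>inverse_delta_le\<close> serve to absorb error terms. Each error costs a fixed power of
  \<open>q\<close>, which explains the large exponents. They are harmless because the constant 1 /
  10 ^ 6 makes \<open>ln q\<close> at most one thousandth of \<open>ln y\<close>: passing from
  \<open>y\<close> to \<open>t\<close> costs a factor of at most \<open>q ^ 63\<close>, which still
  leaves \<open>t\<close> below the cube of the sieving limit, and it confines the smaller prime of
  a two-prime survivor to an interval whose logarithmic length is of order \<open>ln q\<close>. The
  hypotheses do not say that the character is nonprincipal; principal characters are excluded
  separately, since neither zeta nor the missing Euler factors vanish on the open interval from 0 to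
  1.\<close>

lemma abel_bound:
  fixes g b :: "nat \<Rightarrow> real"
  assumes H: "\<And>N. \<bar>\<Sum>n\<in>{M<..N}. g n\<bar> \<le> K"
    and dec: "\<And>n. n > M \<Longrightarrow> b (Suc n) \<le> b n"
    and nonneg: "\<And>n. n > M \<Longrightarrow> 0 \<le> b n"
  shows "\<bar>\<Sum>n\<in>{M<..N}. g n * b n\<bar> \<le> K * b (Suc M)"
proof (cases "M \<le> N")
  case False
  have "0 \<le> K" using H[of 0] by linarith
  with False nonneg[of "Suc M"] show ?thesis by simp
next
  case True
  define G where "G n = (\<Sum>k\<in>{M<..n}. g k)" for n
  have ins: "{M<..Suc n} = insert (Suc n) {M<..n}" if "M \<le> n" for n
    using that by auto
  have parts: "(\<Sum>n\<in>{M<..N}. g n * b n)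
      = G N * b (Suc N) + (\<Sum>n\<in>{M<..N}. G n * (b n - b (Suc n)))"
    using True
  proof (induction N rule: dec_induct)
    case base
    show ?case by (simp add: G_def)
  next
    case (step n)
    have "G (Suc n) = G n + g (Suc n)"
      using step.hyps by (simp add: G_def ins)
    then show ?case
      using step by (simp add: ins algebra_simps)
  qed
  have tele: "(\<Sum>n\<in>{M<..N}. b n - b (Suc n)) = b (Suc M) - b (Suc N)"
    using True by (induction N rule: dec_induct) (simp_all add: ins)
  have "\<bar>\<Sum>n\<in>{M<..N}. G n * (b n - b (Suc n))\<bar> \<le> (\<Sum>n\<in>{M<..N}. K * (b n - b (Suc n)))"
  proof (rule order.trans[OF sum_abs sum_mono])
    fix n assume "n \<in> {M<..N}"
    then show "\<bar>G n * (b n - b (Suc n))\<bar> \<le> K * (b n - b (Suc n))"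
      using dec[of n] H[of n] by (auto simp: abs_mult G_def intro!: mult_right_mono)
  qed
  also have "\<dots> = K * (b (Suc M) - b (Suc N))"
    by (simp add: sum_distrib_left[symmetric] tele)
  finally have "\<bar>\<Sum>n\<in>{M<..N}. G n * (b n - b (Suc n))\<bar> \<le> K * (b (Suc M) - b (Suc N))" .
  \<comment> \<open>The boundary term restores exactly what the telescoped sum lacks, leaving
    \<open>K * b (Suc M)\<close>.\<close>
  moreover have "\<bar>G N * b (Suc N)\<bar> \<le> K * b (Suc N)"
    using nonneg[of "Suc N"] True H[of N] by (auto simp: abs_mult G_def intro!: mult_right_mono)
  ultimately show ?thesis
    unfolding parts by (simp add: algebra_simps)
qed

lemma sum_greaterThanAtMost_split:
  "M \<le> N \<Longrightarrow> (\<Sum>n\<in>{0<..N}. g n) = (\<Sum>n\<in>{0<..M}. g n) + (\<Sum>n\<in>{M<..N}. g n)"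
  for g :: "nat \<Rightarrow> real"
  by (subst sum.union_disjoint[symmetric]) (auto intro: sum.cong)

text \<open>The complex character on the integers is reduced to its real values on the naturals.
  Being nonprincipal is recorded by an argument of value \<open>-1\<close>, because multiplication
  by such an argument reverses signs in \<open>sum_f_period\<close> and exchanges the two kinds of
  residue classes in \<open>totient_le_card_f_eq_1\<close>.\<close>

locale real_char =
  fixes q :: nat and f :: "nat \<Rightarrow> real"
  assumes q_pos: "q > 0"
    and mult: "f (m * n) = f m * f n"
    and period: "f (n + q) = f n"
    and nonzero_iff: "f n \<noteq> 0 \<longleftrightarrow> coprime n q"
    and vals: "f n \<in> {-1, 0, 1}"
    and nonprincipal: "\<exists>n. f n = -1"
begin

lemma f_add_mult: "f (n + k * q) = f n"
proof (induction k)
  case (Suc k)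
  then show ?case using period[of "n + k * q"] by (simp add: algebra_simps)
qed simp

lemma f_mod: "f (n mod q) = f n"
  using f_add_mult[of "n mod q" "n div q"] by (simp add: mult.commute)

lemma f_cong: "[m = n] (mod q) \<Longrightarrow> f m = f n"
  by (metis cong_def f_mod)

lemma f_1: "f 1 = 1"
proof -
  have "f 1 \<noteq> 0" by (simp add: nonzero_iff)
  moreover have "f 1 = f 1 * f 1" using mult[of 1 1] by simp
  ultimately show ?thesis by simp
qed

lemma q_gt_2: "q > 2"
proof (rule ccontr)
  assume "\<not> q > 2"
  obtain n where n: "f n = -1" using nonprincipal by blast
  have "coprime (n mod q) q" using n nonzero_iff[of "n mod q"] by (simp add: f_mod)
  moreover have "n mod q < q" using q_pos by simp
  moreover have "q = 1 \<or> q = 2" using \<open>\<not> q > 2\<close> q_pos by linarith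
  ultimately have "n mod q = 1 mod q"
    by (cases "n mod q") (auto simp: less_Suc_eq)
  then have "f n = f 1" by (metis f_mod)
  with n f_1 show False by simp
qed

lemma f_0 [simp]: "f 0 = 0"
  using nonzero_iff[of 0] q_gt_2 by simp

lemma f_abs_le: "\<bar>f n\<bar> \<le> 1"
  using vals[of n] by auto

lemma f_pow: "f (n ^ k) = f n ^ k"
  by (induction k) (simp_all add: f_1[simplified] mult)

text \<open>Multiplication by \<open>a\<close> with \<open>f a = -1\<close> permutes the residues
  modulo \<open>q\<close> and reverses the sign of the sum.\<close>

lemma sum_f_period: "(\<Sum>n<q. f n) = 0"
proof -
  obtain a where a: "f a = -1" using nonprincipal by blast
  then have cop: "coprime a q" using nonzero_iff[of a] by simp
  have inj: "inj_on (\<lambda>n. a * n mod q) {..<q}"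
  proof (rule inj_onI)
    fix m n assume *: "m \<in> {..<q}" "n \<in> {..<q}" "a * m mod q = a * n mod q"
    then have "[a * m = a * n] (mod q)" by (simp add: cong_def)
    then have "[m = n] (mod q)" using cop cong_mult_lcancel_nat by blast
    with * show "m = n" by (simp add: cong_def)
  qed
  have "(\<lambda>n. a * n mod q) ` {..<q} \<subseteq> {..<q}" using q_pos by auto
  then have img: "(\<lambda>n. a * n mod q) ` {..<q} = {..<q}"
    using inj by (simp add: endo_inj_surj)
  have "(\<Sum>n<q. f n) = (\<Sum>n<q. f (a * n mod q))"
    by (subst img[symmetric], subst sum.reindex[OF inj]) simp
  also have "\<dots> = - (\<Sum>n<q. f n)"
    by (simp add: f_mod mult a sum_negf)
  finally show ?thesis by simp
qed

lemma sum_f_lessThan_mult: "(\<Sum>n<k * q. f n) = 0"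
proof (induction k)
  case (Suc k)
  have "(\<Sum>n<Suc k * q. f n) = (\<Sum>n<k * q. f n) + (\<Sum>n<q. f (n + k * q))"
    using sum.nat_group[of f q "Suc k"] sum.nat_group[of f q k]
      sum.shift_bounds_nat_ivl[of f 0 "k * q" q]
    by (simp add: atLeast0LessThan add.commute)
  with Suc show ?case by (simp add: f_add_mult sum_f_period)
qed simp

lemma sum_f_lessThan_le: "\<bar>\<Sum>n<N. f n\<bar> \<le> q"
proof -
  have "(\<Sum>n<N. f n) = (\<Sum>n<N div q * q. f n) + (\<Sum>n\<in>{N div q * q..<N}. f n)"
    using sum.atLeastLessThan_concat[of 0 "N div q * q" N f]
    by (simp add: atLeast0LessThan)
  then have "\<bar>\<Sum>n<N. f n\<bar> \<le> (\<Sum>n\<in>{N div q * q..<N}. \<bar>f n\<bar>)"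
    by (simp add: sum_f_lessThan_mult)
  also have "\<dots> \<le> (\<Sum>n\<in>{N div q * q..<N}. 1)"
    by (intro sum_mono f_abs_le)
  also have "\<dots> = real (N mod q)"
    by (simp add: minus_div_mult_eq_mod)
  also have "\<dots> \<le> q" using q_pos by (simp add: less_imp_le)
  finally show ?thesis .
qed

lemma sum_f_atMost_le: "\<bar>\<Sum>n\<in>{0<..N}. f n\<bar> \<le> q"
proof -
  have "{..<Suc N} = insert 0 {0<..N}" by auto
  then show ?thesis using sum_f_lessThan_le[of "Suc N"] by simp
qed

lemma sum_f_interval_le: "\<bar>\<Sum>n\<in>{M<..N}. f n\<bar> \<le> 2 * real q"
proof (cases "M \<le> N")
  case True
  then have "(\<Sum>n\<in>{0<..N}. f n) = (\<Sum>n\<in>{0<..M}. f n) + (\<Sum>n\<in>{M<..N}. f n)"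
    by (subst sum.union_disjoint[symmetric]) (auto intro: sum.cong)
  with sum_f_atMost_le[of M] sum_f_atMost_le[of N] show ?thesis by linarith
qed simp

lemma f_abel:
  fixes b :: "nat \<Rightarrow> real"
  assumes "\<And>n. n > M \<Longrightarrow> b (Suc n) \<le> b n" "\<And>n. n > M \<Longrightarrow> 0 \<le> b n"
  shows "\<bar>\<Sum>n\<in>{M<..N}. f n * b n\<bar> \<le> 2 * real q * b (Suc M)"
  using sum_f_interval_le assms by (intro abel_bound) auto

lemma f_powr_abel:
  assumes "\<sigma> \<ge> 0"
  shows "\<bar>\<Sum>n\<in>{M<..N}. f n * real n powr - \<sigma>\<bar> \<le> 2 * real q * real (Suc M) powr - \<sigma>"
  using assms by (intro f_abel powr_mono2') auto

text \<open>A limit of partial sums, since absolute convergence fails at the points of interest,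
  \<open>1\<close> and \<open>1 - \<delta>\<close>. \<open>L_tendsto\<close> shows that it exists
  for positive \<sigma>, and \<open>dirichlet_L_eq_L\<close> identifies it with the analytic
  continuation.\<close>

definition L :: "real \<Rightarrow> real" where
  "L \<sigma> = lim (\<lambda>N. \<Sum>n\<in>{0<..N}. f n * real n powr - \<sigma>)"

lemma L_tendsto:
  assumes "\<sigma> > 0"
  shows "(\<lambda>N. \<Sum>n\<in>{0<..N}. f n * real n powr - \<sigma>) \<longlonglongrightarrow> L \<sigma>"
proof -
  have lim0: "(\<lambda>M. 2 * real q * real (Suc M) powr - \<sigma>) \<longlonglongrightarrow> 0"
    using assms by real_asymp
  have "Cauchy (\<lambda>N. \<Sum>n\<in>{0<..N}. f n * real n powr - \<sigma>)"
  proof (rule CauchyI')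
    fix e :: real assume "e > 0"
    with lim0 obtain M0 where M0: "\<And>M. M \<ge> M0 \<Longrightarrow> 2 * real q * real (Suc M) powr - \<sigma> < e"
      by (fastforce dest: order_tendstoD(2) simp: eventually_sequentially)
    have "dist (\<Sum>n\<in>{0<..m}. f n * real n powr - \<sigma>) (\<Sum>n\<in>{0<..n}. f n * real n powr - \<sigma>) < e"
      if "m \<ge> M0" "m < n" for m n
      using that f_powr_abel[of \<sigma> m n] assms M0[of m]
      by (subst sum_greaterThanAtMost_split[of m n]) (auto simp: dist_norm)
    then show "\<exists>M. \<forall>m\<ge>M. \<forall>n>m. dist (\<Sum>n\<in>{0<..m}. f n * real n powr - \<sigma>) (\<Sum>n\<in>{0<..n}. f n * real n powr - \<sigma>) < e"
      by blast
  qed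
  then show ?thesis unfolding L_def by (simp add: Cauchy_convergent_iff convergent_LIMSEQ_iff)
qed

text \<open>This is \<open>f_powr_abel\<close> with the upper limit sent to infinity. It needs no
  absolute convergence, so it serves for \<open>1\<close> and \<open>1 - \<delta>\<close>
  alike.\<close>

lemma L_tail:
  assumes "\<sigma> > 0"
  shows "\<bar>L \<sigma> - (\<Sum>n\<in>{0<..M}. f n * real n powr - \<sigma>)\<bar> \<le> 2 * real q * real (Suc M) powr - \<sigma>"
proof -
  let ?S = "\<lambda>N. \<Sum>n\<in>{0<..N}. f n * real n powr - \<sigma>"
  have "(\<lambda>N. \<bar>?S N - ?S M\<bar>) \<longlonglongrightarrow> \<bar>L \<sigma> - ?S M\<bar>"
    by (intro tendsto_intros L_tendsto assms)
  moreover have "eventually (\<lambda>N. \<bar>?S N - ?S M\<bar> \<le> 2 * real q * real (Suc M) powr - \<sigma>) sequentially"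
    using eventually_ge_at_top[of M]
  proof eventually_elim
    case (elim N)
    then show ?case using f_powr_abel[of \<sigma> M N] assms by (subst sum_greaterThanAtMost_split[OF elim]) auto
  qed
  ultimately show ?thesis
    by (intro tendsto_upperbound) auto
qed

end

subsection \<open>The convolution of a real character with 1\<close>

lemma sum_divisors_swap:
  fixes g :: "nat \<Rightarrow> nat \<Rightarrow> real"
  shows "(\<Sum>n\<in>{0<..N}. \<Sum>d | d dvd n. g d (n div d))
       = (\<Sum>d\<in>{0<..N}. \<Sum>e\<in>{0<..N div d}. g d e)"
proof -
  have "(\<Sum>n\<in>{0<..N}. \<Sum>d | d dvd n. g d (n div d))
      = (\<Sum>(n, d)\<in>(SIGMA n:{0<..N}. {d. d dvd n}). g d (n div d))"
    by (rule sum.Sigma) auto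
  also have "\<dots> = (\<Sum>(d, e)\<in>(SIGMA d:{0<..N}. {0<..N div d}). g d e)"
  proof (rule sum.reindex_bij_witness[of _ "\<lambda>(d, e). (d * e, d)" "\<lambda>(n, d). (d, n div d)"])
    fix a assume "a \<in> (SIGMA n:{0<..N}. {d. d dvd n})"
    then obtain d e where "a = (d * e, d)" "0 < d" "0 < e" "d * e \<le> N"
      by (cases a) (auto elim!: dvdE)
    moreover from this have "d \<le> N" by (cases e) auto
    ultimately show "(case a of (n, d) \<Rightarrow> (d, n div d)) \<in> (SIGMA d:{0<..N}. {0<..N div d})"
      "(case case a of (n, d) \<Rightarrow> (d, n div d) of (d, e) \<Rightarrow> (d * e, d)) = a"
      "(case case a of (n, d) \<Rightarrow> (d, n div d) of (d, e) \<Rightarrow> g d e) = (case a of (n, d) \<Rightarrow> g d (n div d))"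
      by (simp_all add: less_eq_div_iff_mult_less_eq mult.commute)
  next
    fix b assume "b \<in> (SIGMA d:{0<..N}. {0<..N div d})"
    then obtain d e where "b = (d, e)" "0 < d" "0 < e" "d * e \<le> N"
      by (cases b) (auto simp: less_eq_div_iff_mult_less_eq mult.commute)
    then show "(case b of (d, e) \<Rightarrow> (d * e, d)) \<in> (SIGMA n:{0<..N}. {d. d dvd n})"
      "(case case b of (d, e) \<Rightarrow> (d * e, d) of (n, d) \<Rightarrow> (d, n div d)) = b"
      by simp_all
  qed
  also have "\<dots> = (\<Sum>d\<in>{0<..N}. \<Sum>e\<in>{0<..N div d}. g d e)"
    by (rule sum.Sigma[symmetric]) auto
  finally show ?thesis .
qed

text \<open>Suited to multiplicative functions: the full power of one prime is removed, so the
  cofactor is coprime to it and each step contributes one Euler factor.\<close>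

lemma nat_prime_power_induct [consumes 1, case_names one step]:
  fixes n :: nat
  assumes "n > 0" "P 1"
    and step: "\<And>p a m. prime p \<Longrightarrow> \<not> p dvd m \<Longrightarrow> m > 0 \<Longrightarrow> P m \<Longrightarrow> P (p ^ a * m)"
  shows "P n"
  using assms(1)
proof (induction n rule: less_induct)
  case (less n)
  show ?case
  proof (cases "n = 1")
    case False
    then obtain p where p: "prime p" "p dvd n" using prime_factor_nat by blast
    obtain m where m: "n = p ^ multiplicity p n * m" "\<not> p dvd m"
      using multiplicity_decompose'[of n p] less.prems p by (auto simp: prime_nat_iff)
    have "multiplicity p n > 0"
      using p less.prems by (simp add: prime_multiplicity_gt_zero_iff)
    then have "p ^ multiplicity p n > 1" using p prime_gt_1_nat by (intro one_less_power) auto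
    moreover have "m > 0" using m(2) by (auto intro: Nat.gr0I)
    ultimately have "m < n" by (subst m(1)) simp
    then show ?thesis using step[OF p(1) m(2) \<open>m > 0\<close> less.IH, of "multiplicity p n"] m \<open>m > 0\<close> by simp
  qed (use assms(2) in simp)
qed

section \<open>Lambert series against a simple pole: monotone coefficients\<close>

lemma sum_powers_ge:
  fixes x :: real
  assumes "0 \<le> x"
  shows "(\<Sum>i<Suc d. x ^ i) \<ge> real (Suc d) * sqrt x ^ d"
proof -
  define s where "s = sqrt x"
  have x: "x = s\<^sup>2" and "s \<ge> 0" using assms by (auto simp: s_def)
  \<comment> \<open>The terms \<open>x ^ i\<close> and \<open>x ^ (d - i)\<close> have geometric
    mean \<open>sqrt x ^ d\<close>, so pairing them reduces the bound to the arithmetic-geometric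
    mean inequality.\<close>
  have "2 * (\<Sum>i<Suc d. x ^ i) = (\<Sum>i<Suc d. x ^ i) + (\<Sum>i<Suc d. x ^ (Suc d - Suc i))"
    by (subst sum.nat_diff_reindex) simp
  also have "\<dots> = (\<Sum>i<Suc d. x ^ i + x ^ (d - i))"
    by (simp add: sum.distrib)
  also have "\<dots> \<ge> (\<Sum>i<Suc d. 2 * s ^ d)"
  proof (rule sum_mono)
    fix i assume "i \<in> {..<Suc d}"
    then have "s ^ d = s ^ i * s ^ (d - i)" by (simp add: power_add[symmetric])
    moreover have "2 * (s ^ i * s ^ (d - i)) \<le> (s ^ i)\<^sup>2 + (s ^ (d - i))\<^sup>2"
      using sum_squares_bound[of "s ^ i" "s ^ (d - i)"] by (simp add: mult.assoc)
    ultimately show "2 * s ^ d \<le> x ^ i + x ^ (d - i)"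
      by (simp add: x power_mult[symmetric] mult.commute)
  qed
  finally show ?thesis by (simp add: s_def)
qed

text \<open>The coefficients of the difference between a Lambert series and the simple pole that
  approximates it as \<open>x\<close> tends to \<open>1\<close>.\<close>
definition lambert_diff :: "real \<Rightarrow> nat \<Rightarrow> real" where
  "lambert_diff x d = 1 / (real d * (1 - x)) - x ^ d / (1 - x ^ d)"

context
  fixes x :: real
  assumes x: "0 < x" "x < 1"
begin

lemma lambert_diff_eq:
  assumes "d > 0"
  shows "lambert_diff x d = (1 / real d - x ^ d / (\<Sum>i<d. x ^ i)) / (1 - x)"
proof -
  have "1 - x ^ d = (1 - x) * (\<Sum>i<d. x ^ i)" by (rule one_diff_power_eq)
  then show ?thesis
    by (simp add: lambert_diff_def diff_divide_distrib mult.commute)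
qed

lemma lambert_diff_nonneg:
  assumes "d > 0"
  shows "lambert_diff x d \<ge> 0"
proof -
  have "(\<Sum>i<d. x ^ i) \<ge> (\<Sum>i<d. x ^ d)"
    using x by (intro sum_mono power_decreasing) auto
  then have S: "(\<Sum>i<d. x ^ i) \<ge> real d * x ^ d" by simp
  have "0 < real d * x ^ d" using x assms by simp
  with S have "(\<Sum>i<d. x ^ i) > 0" by linarith
  then have "x ^ d / (\<Sum>i<d. x ^ i) \<le> 1 / real d"
    using S assms by (simp add: field_simps)
  then show ?thesis using x by (simp add: lambert_diff_eq[OF assms])
qed

text \<open>Monotonicity is what permits partial summation against \<open>f\<close>. With
  \<open>S d\<close> the geometric sum, it amounts to
  \<open>d * (d + 1) * x ^ d \<le> S d * S (Suc d)\<close>, and the bounds of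
  \<open>sum_powers_ge\<close> for the two factors multiply to the slightly larger power
  \<open>sqrt x ^ (2 * d - 1)\<close>.\<close>

lemma lambert_diff_decreasing:
  assumes "d > 0"
  shows "lambert_diff x (Suc d) \<le> lambert_diff x d"
proof -
  define S where "S = (\<lambda>d. \<Sum>i<d. x ^ i)"
  define s where "s = sqrt x"
  have s: "x = s\<^sup>2" "0 < s" "s < 1" using x by (auto simp: s_def)
  obtain e where e: "d = Suc e" using assms by (cases d) auto
  have "S d \<ge> real d * s ^ e" "S (Suc d) \<ge> real (Suc d) * s ^ d"
    using sum_powers_ge[of x e] sum_powers_ge[of x d] x unfolding S_def s_def e by auto
  moreover have pos: "0 < real d * s ^ e" "0 < real (Suc d) * s ^ d" using s assms by auto
  ultimately have "(real d * s ^ e) * (real (Suc d) * s ^ d) \<le> S d * S (Suc d)"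
    by (intro mult_mono) auto
  moreover have "s ^ d * s ^ d \<le> s ^ e * s ^ d"
    using s e by (intro mult_right_mono power_decreasing) auto
  then have "real d * real (Suc d) * x ^ d \<le> real d * real (Suc d) * (s ^ e * s ^ d)"
    by (intro mult_left_mono) (auto simp: s power_mult[symmetric] power_add[symmetric] mult_2)
  ultimately have key: "real d * real (Suc d) * x ^ d \<le> S d * S (Suc d)"
    by (simp add: algebra_simps)
  have Spos: "S d > 0" "S (Suc d) > 0"
    using pos \<open>S d \<ge> _\<close> \<open>S (Suc d) \<ge> _\<close> by linarith+
  have rec: "S (Suc d) - x * S d = 1"
  proof -
    have "S (Suc d) = 1 + x * S d"
      unfolding S_def by (subst sum.lessThan_Suc_shift) (simp add: sum_distrib_left)
    then show ?thesis by simp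
  qed
  have "x ^ d / S d - x ^ Suc d / S (Suc d) = x ^ d * (S (Suc d) - x * S d) / (S d * S (Suc d))"
    using Spos by (simp add: field_simps)
  also have "\<dots> = x ^ d / (S d * S (Suc d))" by (simp add: rec)
  also have "\<dots> \<le> 1 / (real d * real (Suc d))"
  proof -
    have "x ^ d \<le> S d * S (Suc d) / (real d * real (Suc d))"
      using key assms by (subst pos_le_divide_eq) (auto simp: mult_ac)
    then show ?thesis using Spos by (subst pos_divide_le_eq) (auto simp: mult_ac)
  qed
  also have "\<dots> = 1 / real d - 1 / real (Suc d)"
    using assms by (simp add: field_simps)
  finally have "1 / real (Suc d) - x ^ Suc d / S (Suc d) \<le> 1 / real d - x ^ d / S d" by linarith
  then show ?thesis
    using x unfolding S_def lambert_diff_eq[OF assms] lambert_diff_eq[OF zero_less_Suc]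
    by (intro divide_right_mono) auto
qed

end

section \<open>Nonnegativity and summatory bounds for the convolution \<open>lam\<close>\<close>

context real_char
begin

definition lam :: "nat \<Rightarrow> real" where
  "lam n = (\<Sum>d | d dvd n. f d)"

lemma sum_lam:
  "(\<Sum>n\<in>{0<..N}. lam n * g n) = (\<Sum>d\<in>{0<..N}. f d * (\<Sum>e\<in>{0<..N div d}. g (d * e)))"
proof -
  have "(\<Sum>n\<in>{0<..N}. lam n * g n) = (\<Sum>n\<in>{0<..N}. \<Sum>d | d dvd n. f d * g (d * (n div d)))"
    unfolding lam_def by (intro sum.cong refl) (auto simp: sum_distrib_right intro: sum.cong)
  also have "\<dots> = (\<Sum>d\<in>{0<..N}. \<Sum>e\<in>{0<..N div d}. f d * g (d * e))"
    by (rule sum_divisors_swap)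
  finally show ?thesis by (simp add: sum_distrib_left)
qed

lemma lam_1: "lam 1 = 1"
  by (simp add: lam_def f_1[simplified])

lemma lam_prime_power_mult:
  assumes p: "prime p" and m: "\<not> p dvd m"
  shows "lam (p ^ a * m) = (\<Sum>i\<le>a. f p ^ i) * lam m"
proof -
  let ?h = "\<lambda>(i, d). p ^ i * d"
  have "m > 0" using m by (auto intro: Nat.gr0I)
  have inj: "inj_on ?h ({..a} \<times> {d. d dvd m})"
  proof (rule inj_onI, clarsimp)
    fix i d j e assume *: "d dvd m" "e dvd m" "p ^ i * d = p ^ j * e"
    have nd: "\<not> p dvd d" "\<not> p dvd e" using * m dvd_trans by blast+
    have "multiplicity p (p ^ i * d) = i" "multiplicity p (p ^ j * e) = j"
      using p nd by (auto intro!: multiplicity_decomposeI simp: prime_nat_iff)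
    then have "i = j" using * by simp
    then show "i = j \<and> d = e" using * p prime_gt_0_nat by auto
  qed
  have img: "?h ` ({..a} \<times> {d. d dvd m}) = {d. d dvd p ^ a * m}"
  proof (intro equalityI subsetI)
    fix d assume "d \<in> {d. d dvd p ^ a * m}"
    then obtain u v where uv: "d = u * v" "u dvd p ^ a" "v dvd m"
      by (auto elim: dvd_productE)
    then obtain i where "i \<le> a" "u = p ^ i" using divides_primepow_nat[OF p] by blast
    with uv show "d \<in> ?h ` ({..a} \<times> {d. d dvd m})" by auto
  qed (auto intro!: mult_dvd_mono le_imp_power_dvd)
  have "lam (p ^ a * m) = (\<Sum>(i, d)\<in>{..a} \<times> {d. d dvd m}. f p ^ i * f d)"
    unfolding lam_def img[symmetric] sum.reindex[OF inj]
    by (intro sum.cong) (auto simp: mult f_pow)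
  also have "\<dots> = (\<Sum>i\<le>a. f p ^ i) * lam m"
    by (simp add: lam_def sum_product sum.cartesian_product)
  finally show ?thesis .
qed

text \<open>The Euler factor is \<open>a + 1\<close> or 1 for \<open>f p\<close> equal to 1 or 0,
  and alternates between 1 and 0 for \<open>f p = -1\<close>; even exponents avoid the
  zeros.\<close>

lemma geometric_sum_f_nonneg: "0 \<le> (\<Sum>i\<le>a. f p ^ i)"
  and geometric_sum_f_even: "1 \<le> (\<Sum>i\<le>2 * a. f p ^ i)"
proof -
  consider "f p = -1" | "f p = 0" | "f p = 1" using vals[of p] by blast
  note c = this
  have alt: "(\<Sum>i\<le>k. (-1::real) ^ i) = (if even k then 1 else 0)" for k
    by (induction k) auto
  show "0 \<le> (\<Sum>i\<le>a. f p ^ i)" using c by cases (auto simp: alt power_0_left)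
  show "1 \<le> (\<Sum>i\<le>2 * a. f p ^ i)" using c by cases (auto simp: alt power_0_left)
qed

lemma lam_nonneg: "n > 0 \<Longrightarrow> lam n \<ge> 0"
proof (induction n rule: nat_prime_power_induct)
  case (step p a m)
  then show ?case by (simp add: lam_prime_power_mult geometric_sum_f_nonneg)
qed (simp_all add: lam_1[simplified])

lemma lam_square: "n > 0 \<Longrightarrow> lam (n\<^sup>2) \<ge> 1"
proof (induction n rule: nat_prime_power_induct)
  case (step p a m)
  have "(p ^ a * m)\<^sup>2 = p ^ (2 * a) * m\<^sup>2"
    by (simp add: power_mult_distrib power_mult[symmetric] mult.commute)
  moreover have "\<not> p dvd m\<^sup>2" using step prime_dvd_power by blast
  ultimately have "lam ((p ^ a * m)\<^sup>2) = (\<Sum>i\<le>2 * a. f p ^ i) * lam (m\<^sup>2)"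
    using step by (simp add: lam_prime_power_mult)
  also have "\<dots> \<ge> 1 * 1"
    using geometric_sum_f_even[of p a] step by (intro mult_mono) auto
  finally show ?case by simp
qed (simp_all add: lam_1[simplified])

text \<open>The Euler factor at \<open>p\<close> grows from \<open>a + 1\<close> to
  \<open>a + 2\<close>. Since \<open>p\<close> may already divide \<open>m\<close>, products
  \<open>m * p\<close> can be formed later without a coprimality condition.\<close>

lemma lam_le_lam_prime_mult:
  assumes p: "prime p" "f p = 1" and "m > 0"
  shows "lam m \<le> lam (p * m)"
proof -
  obtain k where k: "m = p ^ multiplicity p m * k" "\<not> p dvd k"
    using multiplicity_decompose'[of m p] assms by (auto simp: prime_nat_iff)
  define a where "a = multiplicity p m"
  have m: "m = p ^ a * k" using k a_def by simp
  have "k > 0" using k(2) by (auto intro: Nat.gr0I)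
  have "lam m = real (Suc a) * lam k" "lam (p * m) = real (Suc (Suc a)) * lam k"
    using lam_prime_power_mult[OF p(1) k(2), of a] lam_prime_power_mult[OF p(1) k(2), of "Suc a"] p
    by (simp_all add: m mult.assoc)
  then show ?thesis using lam_nonneg[OF \<open>k > 0\<close>] by (simp add: mult_right_mono)
qed

text \<open>The deviation from the pole part is a sum of \<open>f\<close> against a nonnegative
  decreasing sequence with first value 1, so it is at most the bound \<open>q\<close> for the
  partial sums of \<open>f\<close>.\<close>

lemma sum_f_lambert_le:
  assumes x: "0 < x" "x < 1"
  shows "(\<Sum>d\<in>{0<..N}. f d * (x ^ d / (1 - x ^ d)))
       \<le> (\<Sum>d\<in>{0<..N}. f d * real d powr -1) / (1 - x) + q"
proof -
  have "\<bar>\<Sum>d\<in>{0<..N}. f d * lambert_diff x d\<bar> \<le> real q * lambert_diff x (Suc 0)"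
    using sum_f_atMost_le lambert_diff_nonneg[OF x] lambert_diff_decreasing[OF x]
    by (intro abel_bound) auto
  also have "lambert_diff x (Suc 0) = 1"
    using x by (simp add: lambert_diff_def diff_divide_distrib[symmetric])
  finally have "- q \<le> (\<Sum>d\<in>{0<..N}. f d * lambert_diff x d)" by linarith
  also have "(\<Sum>d\<in>{0<..N}. f d * lambert_diff x d)
      = (\<Sum>d\<in>{0<..N}. f d * real d powr -1) / (1 - x) - (\<Sum>d\<in>{0<..N}. f d * (x ^ d / (1 - x ^ d)))"
    unfolding lambert_diff_def sum_divide_distrib sum_subtractf[symmetric]
    using x by (intro sum.cong refl) (auto simp: powr_minus field_simps)
  finally show ?thesis by simp
qed

text \<open>The generating series of \<open>lam\<close> is the Lambert series of \<open>f\<close>.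
  Working with a truncation at \<open>M\<close> keeps all sums finite; its error
  \<open>M * x ^ M / (1 - x)\<close> vanishes in the limit, while the left side only grows with
  \<open>M\<close> because \<open>lam\<close> is nonnegative.\<close>

lemma sum_lam_power_le:
  assumes x: "0 < x" "x < 1"
  shows "(\<Sum>n\<in>{0<..N}. lam n * x ^ n) \<le> L 1 / (1 - x) + q"
proof -
  have trunc: "(\<Sum>n\<in>{0<..M}. lam n * x ^ n)
      \<le> (\<Sum>d\<in>{0<..M}. f d * real d powr -1) / (1 - x) + q + real M * x ^ M / (1 - x)" for M
  proof -
    have "(\<Sum>n\<in>{0<..M}. lam n * x ^ n) = (\<Sum>d\<in>{0<..M}. f d * (\<Sum>e\<in>{0<..M div d}. x ^ (d * e)))"
      by (rule sum_lam)
    also have "\<dots> \<le> (\<Sum>d\<in>{0<..M}. f d * (x ^ d / (1 - x ^ d)) + x ^ M / (1 - x))"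
    proof (rule sum_mono)
      fix d assume d: "d \<in> {0<..M}"
      define k where "k = M div d"
      have xd: "0 < x ^ d" "x ^ d < 1" using x d by (auto simp: power_less_one_iff)
      have geo: "(\<Sum>e\<in>{0<..k}. x ^ (d * e)) = x ^ d / (1 - x ^ d) - x ^ (d * Suc k) / (1 - x ^ d)"
      proof (induction k)
        case (Suc k)
        have "{0<..Suc k} = insert (Suc k) {0<..k}" by auto
        then have "(\<Sum>e\<in>{0<..Suc k}. x ^ (d * e)) = x ^ (d * Suc k) + (\<Sum>e\<in>{0<..k}. x ^ (d * e))"
          by simp
        moreover have "x ^ (d * Suc k) = x ^ (d * Suc k) / (1 - x ^ d) - x ^ (d * Suc (Suc k)) / (1 - x ^ d)"
          using xd by (simp add: diff_divide_distrib[symmetric] nonzero_eq_divide_eq power_add algebra_simps)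
        ultimately show ?case using Suc by linarith
      qed simp
      have "d * Suc k \<ge> M"
        using d unfolding k_def by (simp add: less_imp_le dividend_less_times_div)
      then have "x ^ (d * Suc k) \<le> x ^ M" using x by (intro power_decreasing) auto
      moreover have "x ^ d \<le> x" using x d power_decreasing[of 1 d x] by simp
      ultimately have tail: "x ^ (d * Suc k) / (1 - x ^ d) \<le> x ^ M / (1 - x)"
        using x by (intro frac_le) auto
      have "0 \<le> x ^ (d * Suc k) / (1 - x ^ d)" using x xd by auto
      then have "- f d * (x ^ (d * Suc k) / (1 - x ^ d)) \<le> 1 * (x ^ (d * Suc k) / (1 - x ^ d))"
        using f_abs_le[of d] by (intro mult_right_mono) auto
      then show "f d * (\<Sum>e\<in>{0<..M div d}. x ^ (d * e)) \<le> f d * (x ^ d / (1 - x ^ d)) + x ^ M / (1 - x)"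
        using tail unfolding k_def[symmetric] geo by (simp add: algebra_simps)
    qed
    also have "\<dots> = (\<Sum>d\<in>{0<..M}. f d * (x ^ d / (1 - x ^ d))) + real M * x ^ M / (1 - x)"
      by (simp add: sum.distrib)
    finally show ?thesis using sum_f_lambert_le[OF x, of M] by simp
  qed
  have "(\<lambda>M. (\<Sum>d\<in>{0<..M}. f d * real d powr -1) / (1 - x) + q + real M * x ^ M / (1 - x))
      \<longlonglongrightarrow> L 1 / (1 - x) + q + 0 / (1 - x)"
    using x by (intro tendsto_intros L_tendsto powser_times_n_limit_0) auto
  moreover have "eventually (\<lambda>M. (\<Sum>n\<in>{0<..N}. lam n * x ^ n)
      \<le> (\<Sum>d\<in>{0<..M}. f d * real d powr -1) / (1 - x) + q + real M * x ^ M / (1 - x)) sequentially"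
    using eventually_ge_at_top[of N]
  proof eventually_elim
    case (elim M)
    have "(\<Sum>n\<in>{0<..N}. lam n * x ^ n) \<le> (\<Sum>n\<in>{0<..M}. lam n * x ^ n)"
      using elim x lam_nonneg by (intro sum_mono2) auto
    with trunc[of M] show ?case by linarith
  qed
  ultimately have "(\<Sum>n\<in>{0<..N}. lam n * x ^ n) \<le> L 1 / (1 - x) + q + 0 / (1 - x)"
    by (intro tendsto_lowerbound[where F = sequentially]) auto
  then show ?thesis by simp
qed

text \<open>Take \<open>x = exp (- 1 / X)\<close>, for which \<open>1 / (1 - x) \<le> 2 * X\<close>.
  The sign of \<open>L 1\<close> is still open at this point, hence \<open>max 0\<close>;
  \<open>L_1_ge\<close> settles it from this very bound.\<close>

lemma sum_lam_exp_le:
  assumes "X \<ge> 1"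
  shows "(\<Sum>n\<in>{0<..N}. lam n * exp (- real n / X)) \<le> 2 * X * max 0 (L 1) + q"
proof -
  define x where "x = exp (- 1 / X)"
  have x: "0 < x" "x < 1" using assms by (auto simp: x_def)
  have pw: "exp (- real n / X) = x ^ n" for n
    by (simp add: x_def exp_of_nat_mult[symmetric])
  have "1 / X \<le> 1" "0 \<le> 1 / X" using assms by auto
  have "1 + 1 / X \<le> exp (1 / X)" by (rule exp_ge_add_one_self)
  then have "x \<le> 1 / (1 + 1 / X)"
    using assms by (simp add: x_def exp_minus inverse_eq_divide del: exp_ge_add_one_self) (intro frac_le; simp add: add_pos_nonneg)
  also have "\<dots> \<le> 1 - 1 / (2 * X)" using assms by (simp add: field_simps)
  finally have "1 / (1 - x) \<le> 2 * X" using x assms by (simp add: field_simps)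
  then have "max 0 (L 1) * (1 / (1 - x)) \<le> max 0 (L 1) * (2 * X)"
    by (intro mult_left_mono) auto
  moreover have "L 1 / (1 - x) \<le> max 0 (L 1) * (1 / (1 - x))"
    using x by (simp add: divide_right_mono)
  moreover have "max 0 (L 1) * (2 * X) = 2 * X * max 0 (L 1)" by simp
  ultimately show ?thesis using sum_lam_power_le[OF x, of N] unfolding pw by linarith
qed

text \<open>Squares alone make the sum of \<open>lam\<close> large: the \<open>M\<close> squares up
  to \<open>M ^ 2\<close> contribute at least \<open>M / 3\<close>, against an upper bound
  \<open>2 * M ^ 2 * max 0 (L 1) + q\<close>. The choice \<open>M = 6 * q\<close> makes the left
  side \<open>2 * q\<close>, twice the error term.\<close>

lemma L_1_ge: "L 1 \<ge> 1 / (72 * real q)"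
proof -
  define M where "M = 6 * q"
  have "M > 0" using q_pos by (simp add: M_def)
  let ?X = "real M ^ 2"
  have X: "?X \<ge> 1" using \<open>M > 0\<close> by simp
  have inj: "inj_on (\<lambda>m::nat. m\<^sup>2) {0<..M}" by (auto intro: inj_onI)
  have "real M * exp (-1) = (\<Sum>m\<in>{0<..M}. exp (-1))" by simp
  also have "\<dots> \<le> (\<Sum>m\<in>{0<..M}. lam (m\<^sup>2) * exp (- real (m\<^sup>2) / ?X))"
  proof (rule sum_mono)
    fix m assume m: "m \<in> {0<..M}"
    then have "real (m\<^sup>2) \<le> ?X" by (simp add: power_mono)
    then have "exp (-1) \<le> exp (- real (m\<^sup>2) / ?X)" using \<open>M > 0\<close> by (simp add: field_simps)
    also have "\<dots> \<le> lam (m\<^sup>2) * exp (- real (m\<^sup>2) / ?X)"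
      using lam_square[of m] m by (simp add: mult_le_cancel_right1)
    finally show "exp (-1) \<le> lam (m\<^sup>2) * exp (- real (m\<^sup>2) / ?X)" .
  qed
  also have "\<dots> = (\<Sum>n\<in>(\<lambda>m. m\<^sup>2) ` {0<..M}. lam n * exp (- real n / ?X))"
    by (simp add: sum.reindex[OF inj])
  also have "\<dots> \<le> (\<Sum>n\<in>{0<..M\<^sup>2}. lam n * exp (- real n / ?X))"
    using lam_nonneg by (intro sum_mono2) (auto simp: power_mono)
  also have "\<dots> \<le> 2 * ?X * max 0 (L 1) + q" by (rule sum_lam_exp_le[OF X])
  finally have *: "real M * exp (-1) \<le> 2 * ?X * max 0 (L 1) + q" .
  have "exp (-1) \<ge> (1/3::real)" using exp_le by (simp add: exp_minus field_simps)
  then have "real M * (1/3) \<le> real M * exp (-1)" by (intro mult_left_mono) auto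
  with * have "real q \<le> 72 * real q ^ 2 * max 0 (L 1)" by (simp add: M_def power2_eq_square)
  then have "1 / (72 * real q) \<le> max 0 (L 1)" using q_pos by (simp add: field_simps power2_eq_square)
  moreover have "0 < 1 / (72 * real q)" using q_pos by simp
  ultimately show ?thesis by linarith
qed

lemma L_1_pos: "L 1 > 0"
  using L_1_ge q_pos by (smt (verit) divide_pos_pos of_nat_0_less_iff)

text \<open>On the range of summation the weight \<open>3 * exp (- n / X)\<close> is at least 1, so
  the smoothed bound carries over to the sharp cutoff.\<close>

lemma sum_lam_le:
  assumes "X \<ge> 1" "real N \<le> X"
  shows "(\<Sum>n\<in>{0<..N}. lam n) \<le> 3 * (2 * X * L 1 + q)"
proof -
  have "(\<Sum>n\<in>{0<..N}. lam n) \<le> (\<Sum>n\<in>{0<..N}. 3 * (lam n * exp (- real n / X)))"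
  proof (rule sum_mono)
    fix n assume n: "n \<in> {0<..N}"
    have "exp (real n / X) \<le> exp 1" using n assms by simp
    also have "\<dots> \<le> 3" by (rule exp_le)
    finally have "1 \<le> 3 * exp (- real n / X)" by (simp add: exp_minus field_simps)
    then have "lam n * 1 \<le> lam n * (3 * exp (- real n / X))"
      using lam_nonneg[of n] n by (intro mult_left_mono) auto
    then show "lam n \<le> 3 * (lam n * exp (- real n / X))" by (simp add: algebra_simps)
  qed
  also have "\<dots> = 3 * (\<Sum>n\<in>{0<..N}. lam n * exp (- real n / X))"
    by (simp add: sum_distrib_left)
  also have "\<dots> \<le> 3 * (2 * X * L 1 + q)"
    using sum_lam_exp_le[OF assms(1), of N] L_1_pos by simp
  finally show ?thesis .
qed

end

subsection \<open>Consequences of an exceptional zero\<close>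

lemma powr_Suc_le:
  assumes "\<sigma> \<ge> 0" "n > 0"
  shows "real (Suc n) powr - \<sigma> \<le> real n powr - \<sigma>"
  using assms by (intro powr_mono2') auto

lemma powr_diff_bounds:
  fixes \<delta> a b :: real
  assumes "0 < \<delta>" "\<delta> < 1" "0 < a" "a \<le> b"
  shows "(b powr \<delta> - a powr \<delta>) / \<delta> \<le> (b - a) * a powr (\<delta> - 1)"
    and "(b - a) * b powr (\<delta> - 1) \<le> (b powr \<delta> - a powr \<delta>) / \<delta>"
proof -
  have *: "(b powr \<delta> - a powr \<delta>) / \<delta> \<le> (b - a) * a powr (\<delta> - 1) \<and>
           (b - a) * b powr (\<delta> - 1) \<le> (b powr \<delta> - a powr \<delta>) / \<delta>"
  proof (cases "a = b")
    case False
    then have ab: "a < b" using assms by simp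
    have "\<exists>z. a < z \<and> z < b \<and> b powr \<delta> / \<delta> - a powr \<delta> / \<delta> = (b - a) * z powr (\<delta> - 1)"
    proof (rule MVT2[OF ab])
      fix x assume "a \<le> x"
      then show "((\<lambda>x. x powr \<delta> / \<delta>) has_real_derivative x powr (\<delta> - 1)) (at x)"
        using assms by (auto intro!: derivative_eq_intros simp: powr_diff)
    qed
    then obtain z where z: "a < z" "z < b"
      "(b powr \<delta> - a powr \<delta>) / \<delta> = (b - a) * z powr (\<delta> - 1)"
      by (auto simp: diff_divide_distrib)
    have "z powr (\<delta> - 1) \<le> a powr (\<delta> - 1)" "b powr (\<delta> - 1) \<le> z powr (\<delta> - 1)"
      using z assms by (auto intro!: powr_mono2')
    then show ?thesis unfolding z(3) using ab by (auto intro!: mult_left_mono)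
  qed auto
  then show "(b powr \<delta> - a powr \<delta>) / \<delta> \<le> (b - a) * a powr (\<delta> - 1)"
    and "(b - a) * b powr (\<delta> - 1) \<le> (b powr \<delta> - a powr \<delta>) / \<delta>" by auto
qed

text \<open>The constant \<open>C\<close> is \<open>\<zeta>(1 - \<delta>)\<close>.\<close>
lemma zeta_partial_sum:
  fixes \<delta> :: real
  assumes "0 < \<delta>" "\<delta> < 1"
  obtains C where "- 1 / \<delta> \<le> C" "C \<le> 1 - 1 / \<delta>"
    "(\<lambda>n. (\<Sum>e\<in>{0<..n}. real e powr (\<delta> - 1)) - real n powr \<delta> / \<delta>) \<longlonglongrightarrow> C"
    "\<And>n u. n \<ge> 1 \<Longrightarrow> real n \<le> u \<Longrightarrow> u \<le> real (Suc n) \<Longrightarrow>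
       \<bar>(\<Sum>e\<in>{0<..n}. real e powr (\<delta> - 1)) - (u powr \<delta> / \<delta> + C)\<bar> \<le> real n powr (\<delta> - 1)"
proof -
  define s where "s n = (\<Sum>e\<in>{0<..n}. real e powr (\<delta> - 1)) - real n powr \<delta> / \<delta>" for n
  have ins: "{0<..Suc n} = insert (Suc n) {0<..n}" for n by auto
  have s_Suc: "s (Suc n) = s n + real (Suc n) powr (\<delta> - 1) - (real (Suc n) powr \<delta> - real n powr \<delta>) / \<delta>" for n
    by (simp add: s_def ins diff_divide_distrib del: of_nat_Suc)
  have b: "(real (Suc n) powr \<delta> - real n powr \<delta>) / \<delta> \<le> real n powr (\<delta> - 1)"
          "real (Suc n) powr (\<delta> - 1) \<le> (real (Suc n) powr \<delta> - real n powr \<delta>) / \<delta>" if "n \<ge> 1" for n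
    using powr_diff_bounds[OF assms, of "real n" "real (Suc n)"] that by simp_all
  \<comment> \<open>While \<open>s\<close> decreases, \<open>s n - n powr (\<delta> - 1)\<close>
    increases, so the common limit is trapped between the two for every positive
    \<open>n\<close>.\<close>
  have dec: "s (Suc n) \<le> s n" if "n \<ge> 1" for n using b[OF that] s_Suc[of n] by linarith
  have inc: "s n - real n powr (\<delta> - 1) \<le> s (Suc n) - real (Suc n) powr (\<delta> - 1)" if "n \<ge> 1" for n
    using b[OF that] s_Suc[of n] by linarith
  have "{0<..1::nat} = {1}" by auto
  then have s1: "s 1 = 1 - 1 / \<delta>" by (simp add: s_def)
  have dec': "s n \<le> s m" if "1 \<le> m" "m \<le> n" for m n
    using that(2)
  proof (induction n rule: dec_induct)
    case (step k)
    then show ?case using dec[of k] that(1) by simp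
  qed simp
  have inc': "s m - real m powr (\<delta> - 1) \<le> s n - real n powr (\<delta> - 1)" if "1 \<le> m" "m \<le> n" for m n
    using that(2)
  proof (induction n rule: dec_induct)
    case (step k)
    then show ?case using inc[of k] that(1) by simp
  qed simp
  have low: "- 1 / \<delta> \<le> s n" if "n \<ge> 1" for n
  proof -
    have "- 1 / \<delta> \<le> s n - real n powr (\<delta> - 1)" using inc'[OF _ that] s1 by simp
    then show ?thesis using powr_ge_zero[of "real n" "\<delta> - 1"] by linarith
  qed
  have "decseq (\<lambda>n. s (Suc n))" using dec by (intro decseq_SucI) simp
  moreover have "\<forall>i. - 1 / \<delta> \<le> s (Suc i)" using low by simp
  ultimately obtain C where "(\<lambda>n. s (Suc n)) \<longlonglongrightarrow> C"
    using decseq_convergent by blast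
  then have C: "s \<longlonglongrightarrow> C" by (rule LIMSEQ_imp_Suc)
  have up: "C \<le> s n" if "n \<ge> 1" for n
    using dec'[OF that] by (intro tendsto_upperbound[OF C]) (auto simp: eventually_sequentially)
  have lo: "s n - real n powr (\<delta> - 1) \<le> C" if "n \<ge> 1" for n
  proof (rule tendsto_lowerbound)
    have "(\<lambda>n. real n powr (\<delta> - 1)) \<longlonglongrightarrow> 0" using assms by real_asymp
    then show "(\<lambda>n. s n - real n powr (\<delta> - 1)) \<longlonglongrightarrow> C"
      using tendsto_diff[OF C] by fastforce
  qed (use inc'[OF that] in \<open>auto simp: eventually_sequentially\<close>)
  show ?thesis
  proof (rule that[of C])
    show "- 1 / \<delta> \<le> C" using low by (intro tendsto_lowerbound[OF C]) (auto simp: eventually_sequentially)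
    show "C \<le> 1 - 1 / \<delta>" using up[of 1] s1 by simp
    show "(\<lambda>n. (\<Sum>e\<in>{0<..n}. real e powr (\<delta> - 1)) - real n powr \<delta> / \<delta>) \<longlonglongrightarrow> C"
      using C by (simp add: s_def[abs_def])
    fix n :: nat and u :: real
    assume n: "n \<ge> 1" "real n \<le> u" "u \<le> real (Suc n)"
    have "(u powr \<delta> - real n powr \<delta>) / \<delta> \<le> (u - real n) * real n powr (\<delta> - 1)"
      using powr_diff_bounds(1)[OF assms, of "real n" u] n by simp
    also have "\<dots> \<le> 1 * real n powr (\<delta> - 1)" using n by (intro mult_right_mono) auto
    finally have "u powr \<delta> / \<delta> - real n powr \<delta> / \<delta> \<le> real n powr (\<delta> - 1)"
      by (simp add: diff_divide_distrib)
    moreover have "real n powr \<delta> / \<delta> \<le> u powr \<delta> / \<delta>"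
      using n assms by (intro divide_right_mono powr_mono2) auto
    ultimately show "\<bar>(\<Sum>e\<in>{0<..n}. real e powr (\<delta> - 1)) - (u powr \<delta> / \<delta> + C)\<bar> \<le> real n powr (\<delta> - 1)"
      using up[OF n(1)] lo[OF n(1)] unfolding s_def by linarith
  qed
qed

text \<open>The smallness condition keeps \<open>q ^ k\<close> to the power \<delta> below 3 for
  \<open>k \<le> 42\<close>, and \<open>q ^ 42\<close> is the length of the sum of
  \<open>lam n / n\<close> used later.\<close>

locale exceptional_zero = real_char +
  fixes \<delta> :: real
  assumes delta_pos: "\<delta> > 0"
    and delta_small: "42 * \<delta> * ln (real q) \<le> 1"
    and zero: "L (1 - \<delta>) = 0"
begin

lemma ln_q_ge_1: "ln (real q) \<ge> 1"
proof -
  have "exp 1 \<le> real q" using exp_le q_gt_2 by linarith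
  then show ?thesis using q_pos by (subst ln_ge_iff) auto
qed

lemma delta_lt: "\<delta> \<le> 1 / 42"
proof -
  have "\<delta> * 1 \<le> \<delta> * ln (real q)" using ln_q_ge_1 delta_pos by (intro mult_left_mono) auto
  with delta_small show ?thesis by linarith
qed

lemma q_power_delta_le:
  assumes "k \<le> 42"
  shows "real (q ^ k) powr \<delta> \<le> 3"
proof -
  have "real (q ^ k) powr \<delta> = exp (real k * (\<delta> * ln q))"
    using q_pos by (simp add: powr_def ln_realpow)
  also have "\<dots> \<le> exp 1"
  proof -
    have "real k * (\<delta> * ln q) \<le> 42 * (\<delta> * ln q)"
      using assms delta_pos ln_q_ge_1 by (intro mult_right_mono) auto
    then show ?thesis using delta_small by simp
  qed
  also have "\<dots> \<le> 3" by (rule exp_le)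
  finally show ?thesis .
qed

lemma q_power_ge: "real q ^ k \<ge> 3 ^ k"
  using q_gt_2 by (intro power_mono) auto

text \<open>If \<delta> were tiny, \<open>L 1\<close> would be too close to
  \<open>L (1 - \<delta>) = 0\<close>. Up to \<open>D = q ^ 9\<close> the two series differ by at
  most \<delta>\<open>E\<close> per term, and the tails beyond \<open>D\<close> are below half of
  the lower bound in \<open>L_1_ge\<close>. The exponent 16 is 9 for \<open>D\<close>, 1 from
  \<open>L_1_ge\<close>, and 6 because \<open>432 \<le> 3 ^ 6\<close>.\<close>

lemma inverse_delta_le: "1 / \<delta> \<le> real q ^ 16"
proof -
  define D where "D = q ^ 9"
  have "D > 0" using q_pos by (simp add: D_def)
  define E where "E = real D powr \<delta>"
  have E: "0 < E" "E \<le> 3" using q_power_delta_le[of 9] \<open>D > 0\<close> by (auto simp: E_def D_def)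
  let ?S = "\<lambda>\<sigma>. \<Sum>n\<in>{0<..D}. f n * real n powr - \<sigma>"
  have "L 1 \<le> ?S 1 + 2 * real q * real (Suc D) powr - 1"
    using L_tail[of 1 D] by linarith
  moreover have "?S (1 - \<delta>) \<le> 2 * real q * real (Suc D) powr - (1 - \<delta>)"
    using L_tail[of "1 - \<delta>" D] delta_lt zero by linarith
  moreover have "2 * real q * real (Suc D) powr - 1 \<le> 2 * real q * (1 / real D)"
    using powr_Suc_le[of 1 D] \<open>D > 0\<close> by (intro mult_left_mono) (auto simp: powr_minus divide_inverse)
  moreover have "2 * real q * real (Suc D) powr - (1 - \<delta>) \<le> 2 * real q * (E / real D)"
    using powr_Suc_le[of "1 - \<delta>" D] \<open>D > 0\<close> delta_lt
    by (intro mult_left_mono) (auto simp: E_def powr_diff)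
  moreover have "?S 1 - ?S (1 - \<delta>) \<le> real D * (\<delta> * E)"
  proof -
    have "?S 1 - ?S (1 - \<delta>) \<le> (\<Sum>n\<in>{0<..D}. \<delta> * E)"
      unfolding sum_subtractf[symmetric]
    proof (rule sum_mono)
      fix n assume n: "n \<in> {0<..D}"
      then have n': "real n \<ge> 1" by simp
      have "real n powr \<delta> - 1 \<le> \<delta> * ln n * real n powr \<delta>"
      proof -
        have "1 - \<delta> * ln n \<le> exp (- (\<delta> * ln n))"
          using exp_ge_add_one_self[of "- (\<delta> * ln n)"] by simp
        then have "(1 - \<delta> * ln n) * real n powr \<delta> \<le> exp (- (\<delta> * ln n)) * real n powr \<delta>"
          by (intro mult_right_mono) auto
        also have "\<dots> = 1" using n' by (simp add: powr_def exp_minus)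
        finally show ?thesis by (simp add: algebra_simps)
      qed
      also have "\<dots> \<le> \<delta> * real n * E"
        using n n' delta_pos ln_le_minus_one[of "real n"] unfolding E_def
        by (intro mult_mono powr_mono2) auto
      finally have *: "(real n powr \<delta> - 1) / real n \<le> \<delta> * E"
        using n' by (simp add: field_simps)
      have "f n * real n powr - 1 - f n * real n powr - (1 - \<delta>) = - f n * ((real n powr \<delta> - 1) / real n)"
        using n' by (simp add: powr_minus powr_diff field_simps)
      also have "\<dots> \<le> 1 * ((real n powr \<delta> - 1) / real n)"
        using f_abs_le[of n] n' delta_pos ge_one_powr_ge_zero[of "real n" \<delta>]
        by (intro mult_right_mono) auto
      finally show "f n * real n powr - 1 - f n * real n powr - (1 - \<delta>) \<le> \<delta> * E"
        using * by simp
    qed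
    then show ?thesis by simp
  qed
  ultimately have "L 1 \<le> real D * (\<delta> * E) + 2 * real q * (1 / real D) + 2 * real q * (E / real D)"
    by linarith
  also have "\<dots> \<le> real D * (\<delta> * 3) + 2 * real q * (1 / real D) + 2 * real q * (3 / real D)"
    using E delta_pos by (intro add_mono mult_left_mono divide_right_mono) auto
  also have "\<dots> = 3 * \<delta> * real q ^ 9 + 8 * (real q / real D)" by (simp add: D_def)
  also have "real q / real D = 1 / (real q * real q ^ 7)" using q_pos by (simp add: D_def field_simps eval_nat_numeral)
  also have "8 * (1 / (real q * real q ^ 7)) \<le> 1 / (144 * real q)"
    using q_power_ge[of 7] q_pos by (simp add: field_simps)
  finally have "1 / (144 * real q) \<le> 3 * \<delta> * real q ^ 9" using L_1_ge q_pos by (simp add: field_simps)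
  then have "1 \<le> 432 * (\<delta> * real q ^ 10)" using q_pos by (simp add: field_simps eval_nat_numeral)
  also have "\<dots> \<le> real q ^ 6 * (\<delta> * real q ^ 10)"
    using q_power_ge[of 6] delta_pos by (intro mult_right_mono) auto
  also have "\<dots> = \<delta> * real q ^ 16" by (simp add: eval_nat_numeral)
  finally show ?thesis using delta_pos by (simp add: field_simps)
qed

text \<open>The sum is split at \<open>D\<close>, the square root of \<open>N\<close>. For
  \<open>d \<le> D\<close> the inner sum is replaced by its main term plus the constant
  \<open>C\<close>, the value of zeta at \<open>1 - \<delta>\<close>; the main term gives
  \<open>L 1\<close>, and the constant multiplies \<open>L (1 - \<delta>) = 0\<close>. There remain
  four errors of size at most \<open>2 * q * E^2 / (\<delta> * D)\<close>.\<close>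

lemma sum_lam_powr_approx:
  fixes D N :: nat
  assumes "D > 0" and N: "N = D\<^sup>2" and E: "E = real D powr \<delta>"
  shows "\<bar>(\<Sum>n\<in>{0<..N}. lam n * real n powr (\<delta> - 1)) - real N powr \<delta> * L 1 / \<delta>\<bar>
       \<le> 8 * real q * E\<^sup>2 / (\<delta> * real D)"
proof -
  define Z where "Z n = (\<Sum>e\<in>{0<..n}. real e powr (\<delta> - 1))" for n :: nat
  have d01: "0 < \<delta>" "\<delta> < 1" using delta_pos delta_lt by auto
  obtain C where C: "- 1 / \<delta> \<le> C" "C \<le> 1 - 1 / \<delta>"
    "\<And>n u. n \<ge> 1 \<Longrightarrow> real n \<le> u \<Longrightarrow> u \<le> real (Suc n) \<Longrightarrow>
       \<bar>Z n - (u powr \<delta> / \<delta> + C)\<bar> \<le> real n powr (\<delta> - 1)"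
    unfolding Z_def using zeta_partial_sum[OF d01] by metis
  have absC: "\<bar>C\<bar> \<le> 1 / \<delta>" using C(1,2) d01 by (auto simp: abs_le_iff field_simps)
  have E1: "E \<ge> 1" using assms d01 ge_one_powr_ge_zero[of "real D" \<delta>] by (simp add: E)
  have NE: "real N powr \<delta> = E\<^sup>2" using assms
    by (simp add: power2_eq_square powr_mult)
  have DE: "real D powr (\<delta> - 1) = E / real D" using assms by (simp add: powr_diff)
  have Dsuc: "real (Suc D) powr (\<delta> - 1) \<le> E / real D"
    using powr_Suc_le[of "1 - \<delta>" D] assms d01 by (simp add: powr_diff)
  have "D \<le> N" using assms by (simp add: power2_eq_square)
  have "(\<Sum>n\<in>{0<..N}. lam n * real n powr (\<delta> - 1))
      = (\<Sum>d\<in>{0<..N}. f d * (real d powr (\<delta> - 1) * Z (N div d)))"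
    by (subst sum_lam) (simp add: Z_def powr_mult sum_distrib_left)
  also have "\<dots> = (\<Sum>d\<in>{0<..D}. f d * (real d powr (\<delta> - 1) * Z (N div d)))
               + (\<Sum>d\<in>{D<..N}. f d * (real d powr (\<delta> - 1) * Z (N div d)))"
    by (rule sum_greaterThanAtMost_split[OF \<open>D \<le> N\<close>])
  finally have split: "(\<Sum>n\<in>{0<..N}. lam n * real n powr (\<delta> - 1)) = \<dots>" .

  have Zmono: "Z m \<le> Z n" if "m \<le> n" for m n
    unfolding Z_def using that by (intro sum_mono2) auto
  have Z0: "Z n \<ge> 0" for n unfolding Z_def by (intro sum_nonneg) auto
  \<comment> \<open>Beyond \<open>D\<close> cancellation in \<open>f\<close> suffices: the weight,
    including the factor \<open>Z (N div d)\<close>, decreases in \<open>d\<close>.\<close>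
  have second: "\<bar>\<Sum>d\<in>{D<..N}. f d * (real d powr (\<delta> - 1) * Z (N div d))\<bar> \<le> 2 * real q * (E\<^sup>2 / (\<delta> * real D))"
  proof -
    have "\<bar>\<Sum>d\<in>{D<..N}. f d * (real d powr (\<delta> - 1) * Z (N div d))\<bar>
        \<le> 2 * real q * (real (Suc D) powr (\<delta> - 1) * Z (N div Suc D))"
      by (rule f_abel) (use d01 Z0 in \<open>auto intro!: mult_mono powr_mono2' Zmono div_le_mono2\<close>)
    also have "\<dots> \<le> 2 * real q * (E / real D * (E / \<delta>))"
    proof (intro mult_left_mono mult_mono Dsuc)
      have "N div Suc D \<le> D" using N by (simp add: power2_eq_square div_le_mono2 less_mult_imp_div_less less_imp_le
          less_Suc_eq_le[symmetric])
      then have "Z (N div Suc D) \<le> Z D" by (rule Zmono)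
      also have "Z D \<le> E / \<delta>"
      proof -
        have "\<bar>Z D - (real D powr \<delta> / \<delta> + C)\<bar> \<le> real D powr (\<delta> - 1)"
          using assms by (intro C(3)) auto
        moreover have "real D powr (\<delta> - 1) \<le> 1 powr (\<delta> - 1)"
          using assms d01 by (intro powr_mono2') auto
        ultimately have "Z D \<le> E / \<delta> + (C + 1)" unfolding E by (simp add: abs_le_iff)
        moreover have "1 / \<delta> \<ge> 2" using delta_lt d01 by (simp add: field_simps)
        then have "C + 1 \<le> 0" using C(2) by linarith
        ultimately show ?thesis by linarith
      qed
      finally show "Z (N div Suc D) \<le> E / \<delta>" .
    qed (use Z0 E1 in auto)
    finally show ?thesis by (simp add: power2_eq_square mult_ac)
  qed

  define r where "r d = Z (N div d) - ((real N / real d) powr \<delta> / \<delta> + C)" for d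
  have r: "\<bar>r d\<bar> \<le> 2 * (real N / real d) powr (\<delta> - 1)" if "d \<in> {0<..D}" for d
  proof -
    define n where "n = N div d"
    have d: "0 < d" "d \<le> N" using that \<open>D \<le> N\<close> by auto
    then have n1: "n \<ge> 1" by (simp add: n_def div_greater_zero_iff Suc_le_eq)
    have lo: "real n \<le> real N / real d" 
      using d of_nat_mono[OF div_times_less_eq_dividend[of N d], where ?'a = real]
      by (simp add: n_def le_divide_eq)
    have "N \<le> Suc n * d"
      using dividend_less_div_times[of d N] d by (simp add: n_def)
    then have "real N \<le> real (Suc n) * real d"
      by (metis of_nat_mono of_nat_mult)
    then have hi: "real N / real d \<le> real (Suc n)"
      using d by (simp add: divide_le_eq del: of_nat_Suc)
    have "\<bar>r d\<bar> \<le> real n powr (\<delta> - 1)"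
      unfolding r_def using C(3)[OF n1 lo hi] by (simp add: n_def)
    \<comment> \<open>\<open>N / d\<close> is at most \<open>n + 1\<close>, hence at most
      \<open>2 * n\<close>; replacing \<open>n\<close> by \<open>N / d\<close> thus costs a factor
      of at most 2.\<close>
    also have "\<dots> \<le> ((real N / real d) / 2) powr (\<delta> - 1)"
    proof (rule powr_mono2')
      show "0 < real N / real d / 2" using d by simp
      have "real (Suc n) \<le> 2 * real n" using n1 by simp
      with hi have "real N / real d \<le> 2 * real n" by (rule order.trans)
      then show "real N / real d / 2 \<le> real n" by simp
    qed (use d01 in auto)
    also have "\<dots> = (real N / real d) powr (\<delta> - 1) * 2 powr (1 - \<delta>)"
    proof -
      have half: "(u / 2) powr (\<delta> - 1) = u powr (\<delta> - 1) * 2 powr (1 - \<delta>)" if "u > 0" for u :: real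
        using that by (simp add: powr_divide powr_diff)
      show ?thesis by (rule half) (use d in simp)
    qed
    also have "\<dots> \<le> (real N / real d) powr (\<delta> - 1) * 2 powr 1"
      using d01 by (intro mult_left_mono powr_mono) auto
    finally show ?thesis by simp
  qed
  have R: "\<bar>\<Sum>d\<in>{0<..D}. f d * (real d powr (\<delta> - 1) * r d)\<bar> \<le> 2 * (E\<^sup>2 / real D)"
  proof -
    have "\<bar>\<Sum>d\<in>{0<..D}. f d * (real d powr (\<delta> - 1) * r d)\<bar> \<le> (\<Sum>d\<in>{0<..D}. 2 * real N powr (\<delta> - 1))"
    proof (rule order.trans[OF sum_abs sum_mono])
      fix d assume d: "d \<in> {0<..D}"
      have "\<bar>f d * (real d powr (\<delta> - 1) * r d)\<bar> \<le> 1 * (real d powr (\<delta> - 1) * (2 * (real N / real d) powr (\<delta> - 1)))"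
        unfolding abs_mult using f_abs_le[of d] r[OF d] by (intro mult_mono) auto
      also have "\<dots> = 2 * real N powr (\<delta> - 1)"
        using d by (simp add: powr_divide)
      finally show "\<bar>f d * (real d powr (\<delta> - 1) * r d)\<bar> \<le> 2 * real N powr (\<delta> - 1)" .
    qed
    also have "\<dots> = 2 * (E\<^sup>2 / real D)"
      using assms by (simp add: powr_diff powr_mult power2_eq_square field_simps)
    finally show ?thesis .
  qed
  let ?S = "\<lambda>\<sigma>. \<Sum>n\<in>{0<..D}. f n * real n powr - \<sigma>"
  have "(\<Sum>d\<in>{0<..D}. f d * (real d powr (\<delta> - 1) * Z (N div d)))
      = (\<Sum>d\<in>{0<..D}. E\<^sup>2 / \<delta> * (f d * real d powr - 1) + C * (f d * real d powr - (1 - \<delta>))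
          + f d * (real d powr (\<delta> - 1) * r d))"
  proof (rule sum.cong[OF refl])
    fix d assume d: "d \<in> {0<..D}"
    have "real d powr (\<delta> - 1) * (real N / real d) powr \<delta> = E\<^sup>2 * real d powr - 1"
      using d by (simp add: powr_divide NE powr_diff powr_minus field_simps)
    then have "real d powr (\<delta> - 1) * Z (N div d) =
        E\<^sup>2 * real d powr - 1 / \<delta> + C * real d powr (\<delta> - 1) + real d powr (\<delta> - 1) * r d"
      unfolding r_def by (simp add: algebra_simps)
    then show "f d * (real d powr (\<delta> - 1) * Z (N div d)) = E\<^sup>2 / \<delta> * (f d * real d powr - 1)
        + C * (f d * real d powr - (1 - \<delta>)) + f d * (real d powr (\<delta> - 1) * r d)"
      by (simp add: algebra_simps)
  qed
  also have "\<dots> = E\<^sup>2 / \<delta> * ?S 1 + C * ?S (1 - \<delta>) + (\<Sum>d\<in>{0<..D}. f d * (real d powr (\<delta> - 1) * r d))"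
    by (simp add: sum.distrib sum_distrib_left)
  finally have first: "(\<Sum>d\<in>{0<..D}. f d * (real d powr (\<delta> - 1) * Z (N div d))) = \<dots>" .
  have t1: "\<bar>E\<^sup>2 / \<delta> * ?S 1 - E\<^sup>2 / \<delta> * L 1\<bar> \<le> 2 * real q * (E\<^sup>2 / (\<delta> * real D))"
  proof -
    have "\<bar>L 1 - ?S 1\<bar> \<le> 2 * real q * real (Suc D) powr - 1" using L_tail[of 1 D] by simp
    also have "\<dots> \<le> 2 * real q * (1 / real D)"
      using powr_Suc_le[of 1 D] assms by (intro mult_left_mono) (auto simp: powr_minus divide_inverse)
    finally have "E\<^sup>2 / \<delta> * \<bar>L 1 - ?S 1\<bar> \<le> E\<^sup>2 / \<delta> * (2 * real q * (1 / real D))"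
      using d01 by (intro mult_left_mono) auto
    moreover have "\<bar>k * a - k * b\<bar> = k * \<bar>b - a\<bar>" if "k \<ge> 0" for k a b :: real
      using that by (simp add: abs_mult right_diff_distrib[symmetric] abs_minus_commute)
    from this[of "E\<^sup>2 / \<delta>" "?S 1" "L 1"]
    have "\<bar>E\<^sup>2 / \<delta> * ?S 1 - E\<^sup>2 / \<delta> * L 1\<bar> = E\<^sup>2 / \<delta> * \<bar>L 1 - ?S 1\<bar>" using d01 by simp
    ultimately show ?thesis by (simp add: mult_ac)
  qed
  \<comment> \<open>The zero enters here: the truncated series at \<open>1 - \<delta>\<close> is
    only a tail, which outweighs the possible size \<open>1 / \<delta>\<close> of
    \<open>C\<close>.\<close>
  have t2: "\<bar>C * ?S (1 - \<delta>)\<bar> \<le> 2 * real q * (E\<^sup>2 / (\<delta> * real D))"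
  proof -
    have "\<bar>?S (1 - \<delta>)\<bar> \<le> 2 * real q * real (Suc D) powr (\<delta> - 1)"
      using L_tail[of "1 - \<delta>" D] zero d01 by simp
    also have "\<dots> \<le> 2 * real q * (E / real D)" using Dsuc by (intro mult_left_mono) auto
    also have "\<dots> \<le> 2 * real q * (E\<^sup>2 / real D)"
      using E1 by (intro mult_left_mono divide_right_mono) (auto simp: power2_eq_square)
    finally have "\<bar>C\<bar> * \<bar>?S (1 - \<delta>)\<bar> \<le> 1 / \<delta> * (2 * real q * (E\<^sup>2 / real D))"
      using absC d01 by (intro mult_mono) auto
    then show ?thesis by (simp add: abs_mult)
  qed
  have t3: "2 * (E\<^sup>2 / real D) \<le> 2 * real q * (E\<^sup>2 / (\<delta> * real D))"
  proof -
    have "\<delta> \<le> real q" using d01 q_gt_2 by linarith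
    then have "E\<^sup>2 * \<delta> \<le> E\<^sup>2 * real q" by (intro mult_left_mono) auto
    then show ?thesis using d01 assms by (simp add: field_simps)
  qed
  have gen: "\<bar>(P + Q + R) + S - Y\<bar> \<le> 4 * K"
    if "\<bar>P - Y\<bar> \<le> K" "\<bar>Q\<bar> \<le> K" "\<bar>R\<bar> \<le> K" "\<bar>S\<bar> \<le> K" for P Q R S Y K :: real
    using that by linarith
  have "real N powr \<delta> * L 1 / \<delta> = E\<^sup>2 / \<delta> * L 1" by (simp add: NE)
  moreover have "8 * real q * E\<^sup>2 / (\<delta> * real D) = 4 * (2 * real q * (E\<^sup>2 / (\<delta> * real D)))" by simp
  ultimately show ?thesis
    unfolding split first using gen[OF t1 t2 order.trans[OF R t3] second] by (simp only:)
qed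

text \<open>The exponent 42 is twice 21 = 1 + 16 + 4: one power of \<open>q\<close> from the error
  term, sixteen from \<open>1 / \<delta>\<close>, and four to push the remaining constant 24 below
  1/2. The bound \<open>n powr \<delta> \<le> N powr \<delta>\<close> then makes the factor
  \<open>N powr \<delta>\<close> cancel.\<close>

lemma sum_lam_inverse_ge:
  "(\<Sum>n\<in>{0<..q ^ 42}. lam n / real n) \<ge> 2 / 3 * L 1 / \<delta>"
proof -
  define D where "D = q ^ 21"
  define N where "N = q ^ 42"
  have ND: "N = D\<^sup>2" by (simp add: N_def D_def power_mult[symmetric])
  have "D > 0" "N > 0" using q_pos by (auto simp: D_def N_def)
  define E where "E = real D powr \<delta>"
  define T where "T = (\<Sum>n\<in>{0<..N}. lam n * real n powr (\<delta> - 1))"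
  define Y where "Y = real N powr \<delta> * L 1 / \<delta>"
  have E2: "E\<^sup>2 = real N powr \<delta>" using \<open>D > 0\<close> by (simp add: E_def ND power2_eq_square powr_mult)
  have "\<bar>T - Y\<bar> \<le> 8 * real q * E\<^sup>2 / (\<delta> * real D)"
    unfolding T_def Y_def by (rule sum_lam_powr_approx[OF \<open>D > 0\<close> ND E_def])
  also have "\<dots> = 8 * real q * E\<^sup>2 / real D * (1 / \<delta>)" by simp
  also have "\<dots> \<le> 8 * real q * 3 / real D * real q ^ 16"
    using E2 q_power_delta_le[of 42] inverse_delta_le delta_pos
    by (intro mult_mono divide_right_mono mult_left_mono) (auto simp: N_def)
  also have "\<dots> = 24 / real q ^ 4" using q_pos by (simp add: D_def field_simps eval_nat_numeral)
  also have "\<dots> \<le> 1 / 2" using q_power_ge[of 4] q_pos by (simp add: field_simps)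
  finally have TY: "Y - 1 / 2 \<le> T" by linarith
  \<comment> \<open>The term \<open>n = 1\<close> alone gives 1, so the error 1/2 is at most
    \<open>T / 2\<close>; this is the origin of the factor 2/3.\<close>
  have "1 \<le> T"
  proof -
    have "lam 1 * real 1 powr (\<delta> - 1) \<le> T"
      unfolding T_def using \<open>N > 0\<close> lam_nonneg by (intro member_le_sum) auto
    then show ?thesis by (simp add: lam_1[simplified])
  qed
  with TY have "2 / 3 * Y \<le> T" by linarith
  also have "T \<le> (\<Sum>n\<in>{0<..N}. real N powr \<delta> * (lam n / real n))"
    unfolding T_def
  proof (rule sum_mono)
    fix n assume n: "n \<in> {0<..N}"
    have "lam n * real n powr (\<delta> - 1) = real n powr \<delta> * (lam n / real n)"
      using n by (simp add: powr_diff)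
    also have "\<dots> \<le> real N powr \<delta> * (lam n / real n)"
      using n delta_pos lam_nonneg[of n] by (intro mult_right_mono powr_mono2) auto
    finally show "lam n * real n powr (\<delta> - 1) \<le> real N powr \<delta> * (lam n / real n)" .
  qed
  also have "\<dots> = real N powr \<delta> * (\<Sum>n\<in>{0<..N}. lam n / real n)" by (simp add: sum_distrib_left)
  finally have "real N powr \<delta> * (2 / 3 * L 1 / \<delta>) \<le> real N powr \<delta> * (\<Sum>n\<in>{0<..N}. lam n / real n)"
    by (simp add: Y_def)
  then show ?thesis unfolding N_def[symmetric]
    by (rule mult_left_le_imp_le) (use \<open>N > 0\<close> in simp)
qed

end

subsection \<open>Sums over primes\<close>

lemma binomial_odd_le: "(2 * m + 1) choose m \<le> 4 ^ m"
proof -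
  have "2 * ((2 * m + 1) choose m) = ((2 * m + 1) choose m) + ((2 * m + 1) choose (m + 1))"
    using binomial_symmetric[of m "2 * m + 1"] by simp
  also have "\<dots> = (\<Sum>k\<in>{m, m + 1}. (2 * m + 1) choose k)" by simp
  also have "\<dots> \<le> (\<Sum>k\<le>2 * m + 1. (2 * m + 1) choose k)"
    by (intro sum_mono2) auto
  also have "\<dots> = 2 ^ (2 * m + 1)" by (rule choose_row_sum)
  also have "\<dots> = 2 * 4 ^ m" by (simp add: power_mult)
  finally show ?thesis by simp
qed

lemma prod_primes_dvd:
  fixes n :: nat
  assumes "finite A" "\<And>p. p \<in> A \<Longrightarrow> prime p" "\<And>p. p \<in> A \<Longrightarrow> p dvd n"
  shows "\<Prod>A dvd n"
  using assms
proof (induction A rule: finite_induct)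
  case (insert p A)
  have "coprime p (\<Prod>A)"
    using insert by (intro prod_coprime_right primes_coprime) auto
  then show ?case using insert by (simp add: divides_mult)
qed simp

text \<open>A prime in this range divides the factorial of \<open>2 * m + 1\<close> but neither of
  the factorials in the denominator.\<close>

lemma prod_primes_dvd_binomial:
  "(\<Prod>p | prime p \<and> m + 1 < p \<and> p \<le> 2 * m + 1. p) dvd ((2 * m + 1) choose m)"
proof -
  let ?P = "{p. prime p \<and> m + 1 < p \<and> p \<le> 2 * m + 1}"
  have "p dvd ((2 * m + 1) choose m)" if p: "p \<in> ?P" for p
  proof -
    have "fact m * fact (m + 1) * ((2 * m + 1) choose m) = fact (2 * m + 1)"
      using binomial_fact_lemma[of m "2 * m + 1"] by simp
    moreover have "p dvd fact (2 * m + 1)" using p by (subst prime_dvd_fact_iff) auto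
    moreover have "\<not> p dvd fact m" "\<not> p dvd fact (m + 1)"
      using p by (subst prime_dvd_fact_iff; simp)+
    ultimately show ?thesis using p
      by (metis (mono_tags, lifting) mem_Collect_eq prime_dvd_mult_iff)
  qed
  note dvd = this
  have "finite ?P" by (rule finite_subset[of _ "{..2 * m + 1}"]) auto
  then show ?thesis by (rule prod_primes_dvd) (blast, rule dvd)
qed

text \<open>Erdos's induction: an even \<open>n > 2\<close> is not prime, and for
  \<open>n = 2 * m + 1\<close> the primes up to \<open>m + 1\<close> and those above contribute
  \<open>4 ^ (m + 1)\<close> and \<open>4 ^ m\<close>.\<close>

lemma primorial_le: "(\<Prod>p | prime p \<and> p \<le> n. p) \<le> (4::nat) ^ n"
proof (induction n rule: less_induct)
  case (less n)
  consider "n < 2" | "n = 2" | "n > 2" "even n" | m where "n = 2 * m + 1" "m \<ge> 1"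
  proof -
    have "n < 2 \<or> n = 2 \<or> (n > 2 \<and> even n) \<or> (\<exists>m. n = 2 * m + 1 \<and> m \<ge> 1)" by presburger
    then show thesis using that by blast
  qed
  then show ?case
  proof cases
    case 1
    then have empty: "{p. prime p \<and> p \<le> n} = {}" by (auto dest: prime_ge_2_nat)
    show ?thesis unfolding empty by simp
  next
    case 2
    have "p = 2" if "prime p" "p \<le> 2" for p :: nat
      using prime_ge_2_nat[OF that(1)] that(2) by simp
    then have "{p. prime p \<and> p \<le> 2} = {2::nat}" by auto
    with 2 show ?thesis by simp
  next
    case 3
    have "\<not> prime n" using 3 prime_odd_nat by blast
    then have "p \<le> n - 1" if "prime p" "p \<le> n" for p
      using that by (cases "p = n") auto
    then have "{p. prime p \<and> p \<le> n} = {p. prime p \<and> p \<le> n - 1}" by auto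
    moreover have "(\<Prod>p | prime p \<and> p \<le> n - 1. p) \<le> 4 ^ (n - 1)" using 3 less by simp
    moreover have "(4::nat) ^ (n - 1) \<le> 4 ^ n" by (rule power_increasing) auto
    ultimately show ?thesis by (simp only:)
  next
    case 4
    let ?A = "{p. prime p \<and> p \<le> m + 1}" and ?B = "{p. prime p \<and> m + 1 < p \<and> p \<le> 2 * m + 1}"
    have split: "{p. prime p \<and> p \<le> n} = ?A \<union> ?B"
    proof (rule equalityI; rule subsetI)
      fix p assume "p \<in> {p. prime p \<and> p \<le> n}"
      then show "p \<in> ?A \<union> ?B" using \<open>n = 2 * m + 1\<close> by (cases "p \<le> m + 1") simp_all
    next
      fix p assume "p \<in> ?A \<union> ?B"
      then show "p \<in> {p. prime p \<and> p \<le> n}" using \<open>n = 2 * m + 1\<close> by (elim UnE) simp_all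
    qed
    have fin: "finite ?A" "finite ?B"
      by (rule finite_subset[of _ "{..2 * m + 1}"], auto)+
    have "(\<Prod>p | prime p \<and> p \<le> n. p) = \<Prod>?A * \<Prod>?B"
      unfolding split by (rule prod.union_disjoint[OF fin]) auto
    also have "\<dots> \<le> 4 ^ (m + 1) * ((2 * m + 1) choose m)"
    proof (rule mult_mono)
      show "(\<Prod>p | prime p \<and> p \<le> m + 1. p) \<le> 4 ^ (m + 1)" by (rule less) (use \<open>n = 2 * m + 1\<close> \<open>m \<ge> 1\<close> in linarith)
      show "(\<Prod>p | prime p \<and> m + 1 < p \<and> p \<le> 2 * m + 1. p) \<le> (2 * m + 1) choose m"
        by (rule dvd_imp_le[OF prod_primes_dvd_binomial]) simp
    qed simp_all
    also have "\<dots> \<le> 4 ^ (m + 1) * 4 ^ m" by (intro mult_left_mono binomial_odd_le) auto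
    also have "\<dots> = 4 ^ (m + 1 + m)" by (rule power_add[symmetric])
    also have "m + 1 + m = n" using \<open>n = 2 * m + 1\<close> by linarith
    finally show ?thesis .
  qed
qed

lemma finite_primes_le_real [simp, intro]: "finite {p. prime p \<and> real p \<le> x \<and> P p}"
  by (rule finite_subset[of _ "{..nat \<lfloor>x\<rfloor>}"]) (auto simp: le_nat_floor)

lemma finite_primes_between [simp, intro]: "finite {p. prime p \<and> P p \<and> real p \<le> x}"
  by (rule finite_subset[of _ "{..nat \<lfloor>x\<rfloor>}"]) (auto simp: le_nat_floor)

lemma theta_le:
  assumes "x \<ge> 0"
  shows "(\<Sum>p | prime p \<and> real p \<le> x. ln (real p)) \<le> 2 * x"
proof -
  define n where "n = nat \<lfloor>x\<rfloor>"
  have "{p. prime p \<and> real p \<le> x} = {p. prime p \<and> p \<le> n}"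
    using assms by (auto simp: n_def le_nat_iff le_floor_iff)
  then have "(\<Sum>p | prime p \<and> real p \<le> x. ln (real p)) = (\<Sum>p | prime p \<and> p \<le> n. ln (real p))"
    by simp
  also have "\<dots> = ln (\<Prod>p | prime p \<and> p \<le> n. real p)"
    by (subst ln_prod) (auto simp: prime_gt_0_nat)
  also have "\<dots> \<le> ln (4 ^ n)"
  proof (subst ln_le_cancel_iff)
    have "real (\<Prod>p | prime p \<and> p \<le> n. p) \<le> real (4 ^ n)"
      using primorial_le[of n] of_nat_mono by blast
    then show "(\<Prod>p | prime p \<and> p \<le> n. real p) \<le> 4 ^ n" by simp
  qed (auto intro!: prod_pos simp: prime_gt_0_nat)
  also have "\<dots> = real n * (2 * ln 2)"
    using ln_realpow[of 2 2] by (simp add: ln_realpow)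
  also have "\<dots> \<le> real n * 2" using ln_2_less_1 by (intro mult_left_mono) auto
  also have "\<dots> \<le> 2 * x" using assms by (simp add: n_def)
  finally show ?thesis .
qed

text \<open>Each dyadic block from \<open>u\<close> to \<open>2 * u\<close> contributes at most 4,
  since the logarithms of its primes add up to at most \<open>4 * u\<close>. Counting blocks keeps
  the bound proportional to the logarithmic length of the range, independently of
  \<open>z\<close>.\<close>

lemma sum_prime_log_dyadic:
  assumes "z > 0"
  shows "(\<Sum>p | prime p \<and> z < real p \<and> real p \<le> 2 ^ k * z. ln (real p) / real p) \<le> 4 * real k"
proof (induction k)
  case 0
  have "{p. prime p \<and> z < real p \<and> real p \<le> 2 ^ 0 * z} = {}" by auto
  then show ?case by (simp only: sum.empty)
next
  case (Suc k)
  define u where "u = 2 ^ k * z"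
  have u: "u > 0" using assms by (simp add: u_def)
  have "z \<le> u" using assms by (simp add: u_def mult_le_cancel_right1)
  then have "{p. prime p \<and> z < real p \<and> real p \<le> 2 ^ Suc k * z}
      = {p. prime p \<and> z < real p \<and> real p \<le> 2 ^ k * z} \<union> {p. prime p \<and> u < real p \<and> real p \<le> 2 * u}"
    using u by (auto simp: u_def)
  then have "(\<Sum>p | prime p \<and> z < real p \<and> real p \<le> 2 ^ Suc k * z. ln (real p) / real p)
      = (\<Sum>p | prime p \<and> z < real p \<and> real p \<le> 2 ^ k * z. ln (real p) / real p)
      + (\<Sum>p | prime p \<and> u < real p \<and> real p \<le> 2 * u. ln (real p) / real p)"
    by (simp only:) (rule sum.union_disjoint, auto simp: u_def)
  also have "(\<Sum>p | prime p \<and> u < real p \<and> real p \<le> 2 * u. ln (real p) / real p)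
      \<le> (\<Sum>p | prime p \<and> u < real p \<and> real p \<le> 2 * u. ln (real p) / u)"
    using u prime_ge_1_nat by (intro sum_mono divide_left_mono) (auto intro!: mult_pos_pos dest: prime_gt_0_nat)
  also have "\<dots> \<le> (\<Sum>p | prime p \<and> real p \<le> 2 * u. ln (real p) / u)"
    using u prime_ge_1_nat finite_primes_le_real[of "2 * u" "\<lambda>_. True"]
    by (intro sum_mono2) (auto intro!: divide_nonneg_pos)
  also have "\<dots> = (\<Sum>p | prime p \<and> real p \<le> 2 * u. ln (real p)) / u"
    by (simp add: sum_divide_distrib)
  also have "\<dots> \<le> 2 * (2 * u) / u" using u by (intro divide_right_mono theta_le) auto
  also have "\<dots> = 4" using u by simp
  finally show ?case using Suc by simp
qed

lemma card_primes_between_le: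
  assumes "z > 1" "x \<ge> 0" "(\<Sum>p | prime p \<and> P p \<and> real p \<le> x. ln (real p)) \<le> B"
  shows "real (card {p. prime p \<and> z < real p \<and> P p \<and> real p \<le> x}) \<le> B / ln z"
proof -
  let ?A = "{p. prime p \<and> z < real p \<and> P p \<and> real p \<le> x}"
  have "?A \<subseteq> {p. prime p \<and> P p \<and> real p \<le> x}" by auto
  have "real (card ?A) * ln z = (\<Sum>p\<in>?A. ln z)" by simp
  also have "\<dots> \<le> (\<Sum>p\<in>?A. ln (real p))" using assms by (intro sum_mono) auto
  also have "\<dots> \<le> (\<Sum>p | prime p \<and> P p \<and> real p \<le> x. ln (real p))"
    using prime_ge_1_nat by (intro sum_mono2) auto
  also have "\<dots> \<le> B" by fact
  finally show ?thesis using assms by (simp add: pos_le_divide_eq)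
qed

text \<open>The smaller factor \<open>p\<close> satisfies \<open>p ^ 2 \<le> t\<close>, which
  confines it to \<open>k\<close> dyadic blocks above \<open>z\<close>; for each \<open>p\<close>
  Chebyshev's bound counts the larger factor \<open>r\<close> up to \<open>t / p\<close>. This saves
  two factors \<open>ln z\<close> at the cost of one factor \<open>k\<close>.\<close>

lemma card_semiprimes_le:
  assumes z: "z > 1" and t: "0 \<le> t" "t \<le> 4 ^ k * z\<^sup>2"
  shows "finite {v. real v \<le> t \<and> (\<exists>p r. prime p \<and> prime r \<and> z < real p \<and> p \<le> r \<and> v = p * r)}" (is "finite ?V")
    and "real (card {v. real v \<le> t \<and> (\<exists>p r. prime p \<and> prime r \<and> z < real p \<and> p \<le> r \<and> v = p * r)})
       \<le> 8 * real k * t / (ln z)\<^sup>2"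
proof -
  let ?P = "{p. prime p \<and> z < real p \<and> real p \<le> 2 ^ k * z}"
  \<comment> \<open>The conjunct \<open>True\<close> instantiates the predicate of \<open>card_primes_between_le\<close>.\<close>
  let ?R = "\<lambda>p. {r. prime r \<and> z < real r \<and> True \<and> real r \<le> t / real p}"
  have finP: "finite ?P" and finR: "finite (?R p)" for p by auto
  have sub: "?V \<subseteq> (\<lambda>(p, r). p * r) ` (SIGMA p:?P. ?R p)"
  proof
    fix v assume "v \<in> ?V"
    then obtain p r where *: "real v \<le> t" "prime p" "prime r" "z < real p" "p \<le> r" "v = p * r" by blast
    have "(real p)\<^sup>2 \<le> real p * real r" using * by (simp add: power2_eq_square mult_left_mono)
    also have "\<dots> \<le> t" using * by simp
    also have "\<dots> \<le> 4 ^ k * z\<^sup>2" by (rule t)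
    also have "\<dots> = (2 ^ k * z)\<^sup>2" by (simp add: power_mult_distrib power_mult[symmetric] mult.commute[of k] power_mult)
    finally have "real p \<le> 2 ^ k * z" by (rule power2_le_imp_le) (use z in auto)
    moreover have "real r \<le> t / real p"
      using * prime_gt_0_nat[of p] by (simp add: pos_le_divide_eq mult.commute)
    moreover have "z < real r" using * by linarith
    ultimately show "v \<in> (\<lambda>(p, r). p * r) ` (SIGMA p:?P. ?R p)" using * by force
  qed
  have fin: "finite (SIGMA p:?P. ?R p)" using finP finR by (rule finite_SigmaI)
  show "finite ?V" using sub fin finite_surj by blast
  have "card ?V \<le> card (SIGMA p:?P. ?R p)" using sub fin by (rule surj_card_le[rotated])
  also have "\<dots> = (\<Sum>p\<in>?P. card (?R p))" using finP finR by (intro card_SigmaI) auto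
  finally have "real (card ?V) \<le> (\<Sum>p\<in>?P. real (card (?R p)))"
    by (simp only: of_nat_sum[symmetric] of_nat_le_iff)
  also have "\<dots> \<le> (\<Sum>p\<in>?P. 2 * t / (ln z)\<^sup>2 * (ln (real p) / real p))"
  proof (rule sum_mono)
    fix p assume p: "p \<in> ?P"
    have pz: "ln z \<le> ln (real p)" "real p > 0" using p z by auto
    have "real (card (?R p)) \<le> 2 * (t / real p) / ln z"
      using t z theta_le[of "t / real p"] by (intro card_primes_between_le) auto
    \<comment> \<open>A factor of at least 1 is inserted to turn the weight \<open>1 / p\<close>
      into \<open>ln p / p\<close>, which the dyadic bound controls.\<close>
    also have "\<dots> \<le> 2 * (t / real p) / ln z * (ln (real p) / ln z)"
    proof -
      have "1 \<le> ln (real p) / ln z" using pz z by (simp add: le_divide_eq)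
      moreover have "0 \<le> 2 * (t / real p) / ln z" using t z by simp
      ultimately show ?thesis using mult_left_mono[of 1] by fastforce
    qed
    also have "\<dots> = 2 * t / (ln z)\<^sup>2 * (ln (real p) / real p)" by (simp add: power2_eq_square)
    finally show "real (card (?R p)) \<le> 2 * t / (ln z)\<^sup>2 * (ln (real p) / real p)" .
  qed
  also have "\<dots> = 2 * t / (ln z)\<^sup>2 * (\<Sum>p\<in>?P. ln (real p) / real p)" by (rule sum_distrib_left[symmetric])
  also have "\<dots> \<le> 2 * t / (ln z)\<^sup>2 * (4 * real k)"
    using t z by (intro mult_left_mono sum_prime_log_dyadic) auto
  finally show "real (card ?V) \<le> 8 * real k * t / (ln z)\<^sup>2" by (simp add: mult_ac)
qed

lemma sum_ln_prime_divisors_le: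
  assumes "n > 0"
  shows "(\<Sum>p | p dvd n \<and> prime p. ln (real p)) \<le> ln (real n)"
proof -
  have eq: "{p. p dvd n \<and> prime p} = prime_factors n"
    using assms by (simp add: set_eq_iff in_prime_factors_iff conj_commute)
  have pos: "real p > 0" if "p \<in> prime_factors n" for p
    using in_prime_factors_imp_prime[OF that] by (simp add: prime_gt_0_nat)
  have "(\<Sum>p\<in>prime_factors n. ln (real p)) = ln (\<Prod>p\<in>prime_factors n. real p)"
    by (rule ln_prod[symmetric], simp, drule pos, simp)
  also have "\<dots> \<le> ln (real n)"
  proof (subst ln_le_cancel_iff)
    have "(\<Prod>p\<in>prime_factors n. p) \<le> (\<Prod>p\<in>prime_factors n. p ^ multiplicity p n)"
    proof (rule prod_mono)
      fix p assume p: "p \<in> prime_factors n"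
      then have "prime p" "p dvd n" by (simp_all add: in_prime_factors_iff)
      then have "multiplicity p n > 0" using assms by (simp add: prime_multiplicity_gt_zero_iff)
      then show "0 \<le> p \<and> p \<le> p ^ multiplicity p n"
        using \<open>prime p\<close> prime_ge_1_nat by (simp add: self_le_power)
    qed
    also have "\<dots> = n" using prod_prime_factors[of n] assms by simp
    finally have "real (\<Prod>p\<in>prime_factors n. p) \<le> real n" by (rule of_nat_mono)
    then show "(\<Prod>p\<in>prime_factors n. real p) \<le> real n" by (simp only: of_nat_prod)
  next
    show "(\<Prod>p\<in>prime_factors n. real p) > 0" by (rule prod_pos) (rule pos)
  qed (use assms in simp)
  finally show ?thesis unfolding eq .
qed

section \<open>Scarcity of the primes with \<open>f p = 1\<close>\<close>

context real_char
begin

text \<open>The pairs \<open>(m, p)\<close> are grouped by \<open>n = m * p\<close>. Since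
  \<open>lam m \<le> lam n\<close>, each \<open>n\<close> receives at most \<open>lam n\<close>
  times the sum of \<open>ln p\<close> over its prime divisors, which is at most
  \<open>ln n\<close>.\<close>

lemma sum_lam_theta_le:
  assumes "X \<ge> 1" "M \<le> X"
  shows "(\<Sum>m\<in>{0<..M}. lam m * (\<Sum>p | prime p \<and> f p = 1 \<and> p \<le> X div m. ln (real p)))
       \<le> ln (real X) * (\<Sum>n\<in>{0<..X}. lam n)"
proof -
  define h where "h m p = (if prime p \<and> f p = 1 then lam (m * p) * ln (real p) else 0)" for m p
  have fin: "finite {p. prime p \<and> f p = 1 \<and> p \<le> k}" for k
    by (rule finite_subset[of _ "{..k}"]) auto
  have "(\<Sum>m\<in>{0<..M}. lam m * (\<Sum>p | prime p \<and> f p = 1 \<and> p \<le> X div m. ln (real p)))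
      \<le> (\<Sum>m\<in>{0<..X}. lam m * (\<Sum>p | prime p \<and> f p = 1 \<and> p \<le> X div m. ln (real p)))"
    using assms lam_nonneg prime_ge_1_nat by (intro sum_mono2) (auto intro!: mult_nonneg_nonneg sum_nonneg)
  also have "\<dots> \<le> (\<Sum>m\<in>{0<..X}. \<Sum>p\<in>{0<..X div m}. h m p)"
  proof (rule sum_mono)
    fix m assume m: "m \<in> {0<..X}"
    have "lam m * (\<Sum>p | prime p \<and> f p = 1 \<and> p \<le> X div m. ln (real p))
        \<le> (\<Sum>p | prime p \<and> f p = 1 \<and> p \<le> X div m. h m p)"
      unfolding sum_distrib_left h_def
    proof (rule sum_mono)
      fix p assume p: "p \<in> {p. prime p \<and> f p = 1 \<and> p \<le> X div m}"
      have "lam m * ln (real p) \<le> lam (m * p) * ln (real p)"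
        using lam_le_lam_prime_mult[of p m] p m prime_ge_1_nat[of p]
        by (intro mult_right_mono) (auto simp: mult.commute)
      then show "lam m * ln (real p) \<le> (if prime p \<and> f p = 1 then lam (m * p) * ln (real p) else 0)"
        using p by simp
    qed
    also have "\<dots> = (\<Sum>p\<in>{0<..X div m}. h m p)"
      by (rule sum.mono_neutral_left) (auto simp: h_def prime_gt_0_nat)
    finally show "lam m * (\<Sum>p | prime p \<and> f p = 1 \<and> p \<le> X div m. ln (real p)) \<le> \<dots>" .
  qed
  also have "\<dots> = (\<Sum>n\<in>{0<..X}. \<Sum>m | m dvd n. h m (n div m))"
    by (rule sum_divisors_swap[symmetric])
  also have "\<dots> \<le> (\<Sum>n\<in>{0<..X}. ln (real X) * lam n)"
  proof (rule sum_mono)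
    fix n assume n: "n \<in> {0<..X}"
    have "(\<Sum>m | m dvd n. h m (n div m)) = (\<Sum>p | p dvd n. h (n div p) p)"
      using n by (intro sum.reindex_bij_witness[of _ "\<lambda>d. n div d" "\<lambda>d. n div d"]) (auto elim!: dvdE)
    also have "\<dots> = (\<Sum>p | p dvd n. lam n * (if prime p \<and> f p = 1 then ln (real p) else 0))"
      by (intro sum.cong) (auto simp: h_def)
    also have "\<dots> \<le> (\<Sum>p | p dvd n. lam n * (if prime p then ln (real p) else 0))"
      using lam_nonneg[of n] n prime_ge_1_nat by (intro sum_mono mult_left_mono) auto
    also have "\<dots> = lam n * (\<Sum>p | p dvd n \<and> prime p. ln (real p))"
      using n by (simp add: sum_distrib_left[symmetric] sum.inter_filter[symmetric])
    also have "\<dots> \<le> lam n * ln (real n)"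
      using n lam_nonneg[of n] by (intro mult_left_mono sum_ln_prime_divisors_le) auto
    also have "\<dots> \<le> lam n * ln (real X)"
      using n lam_nonneg[of n] by (intro mult_left_mono) auto
    finally show "(\<Sum>m | m dvd n. h m (n div m)) \<le> ln (real X) * lam n" by (simp add: mult.commute)
  qed
  finally show ?thesis by (simp add: sum_distrib_left)
qed

end

context exceptional_zero
begin

text \<open>If every \<open>m\<close> failed, averaging with weights \<open>lam m\<close> would
  contradict \<open>sum_lam_theta_le\<close>. After \<delta> and \<open>L 1\<close> cancel, the
  comparison is 14 * 2/3 = 28/3 against 3 * (2 + 1) = 9, so 14 is just large enough. Nothing more is
  learnt about which \<open>m\<close> succeeds.\<close>

lemma obtain_sparse_scale:
  assumes X: "X \<ge> q ^ 42"
  obtains m where "m \<in> {0<..q ^ 42}"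
    "(\<Sum>p | prime p \<and> f p = 1 \<and> p \<le> X div m. ln (real p)) \<le> 14 * \<delta> * (real X / real m) * ln (real X)"
proof -
  note obt = that
  let ?\<theta> = "\<lambda>m. \<Sum>p | prime p \<and> f p = 1 \<and> p \<le> X div m. ln (real p)"
  have Xge: "real X \<ge> real q ^ 42" using X by (metis of_nat_mono of_nat_power)
  \<comment> \<open>This feeds \<open>q \<le> X * L 1\<close>, which lets the error term
    \<open>q\<close> of \<open>sum_lam_le\<close> be absorbed in its main term.\<close>
  have "72 * real q ^ 2 \<le> real q ^ 40 * real q ^ 2" using q_power_ge[of 40] by (intro mult_right_mono) auto
  also have "\<dots> = real q ^ 42" by (simp add: power_add[symmetric])
  also note Xge
  finally have X2: "72 * real q ^ 2 \<le> real X" .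
  have "real q \<le> real X * (1 / (72 * real q))"
    using X2 q_pos by (simp add: pos_le_divide_eq power2_eq_square mult_ac)
  also have "\<dots> \<le> real X * L 1" using L_1_ge by (intro mult_left_mono) auto
  finally have qX: "real q \<le> real X * L 1" .
  have "1 < real X" using X2 q_gt_2 self_le_power[of "real q" 2] by linarith
  then have pos: "0 < ln (real X) * (real X * L 1)" using L_1_pos by auto
  show thesis
  proof (rule ccontr)
    assume "\<not> thesis"
    have big: "?\<theta> m \<ge> 14 * \<delta> * (real X / real m) * ln (real X)" if "m \<in> {0<..q ^ 42}" for m
    proof (rule ccontr)
      assume "\<not> ?thesis"
      then have "?\<theta> m \<le> 14 * \<delta> * (real X / real m) * ln (real X)" by (simp only: not_le less_imp_le)
      with \<open>\<not> thesis\<close> obt that show False by blast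
    qed
    have "14 * \<delta> * real X * ln (real X) * (2 / 3 * L 1 / \<delta>)
        \<le> 14 * \<delta> * real X * ln (real X) * (\<Sum>m\<in>{0<..q ^ 42}. lam m / real m)"
      using sum_lam_inverse_ge delta_pos \<open>1 < real X\<close> by (intro mult_left_mono) auto
    also have "\<dots> = (\<Sum>m\<in>{0<..q ^ 42}. lam m * (14 * \<delta> * (real X / real m) * ln (real X)))"
      unfolding sum_distrib_left by (intro sum.cong) auto
    also have "\<dots> \<le> (\<Sum>m\<in>{0<..q ^ 42}. lam m * ?\<theta> m)"
      using big lam_nonneg by (intro sum_mono mult_left_mono) auto
    also have "\<dots> \<le> ln (real X) * (\<Sum>n\<in>{0<..X}. lam n)"
      using X \<open>1 < real X\<close> by (intro sum_lam_theta_le) auto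
    also have "\<dots> \<le> ln (real X) * (3 * (2 * real X * L 1 + q))"
      using \<open>1 < real X\<close> by (intro mult_left_mono sum_lam_le) auto
    also have "\<dots> \<le> ln (real X) * (3 * (2 * real X * L 1 + real X * L 1))"
      using qX \<open>1 < real X\<close> by (intro mult_left_mono) auto
    finally have "28 / 3 * (ln (real X) * (real X * L 1)) \<le> 9 * (ln (real X) * (real X * L 1))"
      using delta_pos by (simp add: field_simps)
    then show False using pos by linarith
  qed
qed

end

subsection \<open>Analytic continuation\<close>

text \<open>On the disc of radius \<open>Re x / 2\<close> about \<open>x\<close> the exponent stays
  below \<open>-1\<close> by a fixed amount, so the Weierstrass test applies locally.\<close>

lemma holomorphic_sums_powr_bound:
  fixes t :: "nat \<Rightarrow> complex \<Rightarrow> complex"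
  assumes S: "open S" "S \<subseteq> {s. Re s > 0}"
    and hol: "\<And>n. t n holomorphic_on S"
    and B: "B \<ge> 0"
    and bound: "\<And>n s. s \<in> S \<Longrightarrow> norm (t n s) \<le> B * norm s * real (Suc n) powr (- Re s - 1)"
  obtains g where "g holomorphic_on S" "\<And>s. s \<in> S \<Longrightarrow> (\<lambda>n. t n s) sums g s"
proof -
  have loc: "\<exists>d h. 0 < d \<and> summable h \<and> range h \<subseteq> \<real>\<^sub>\<ge>\<^sub>0 \<and>
      (\<forall>\<^sub>F n in sequentially. \<forall>y\<in>ball x d \<inter> S. cmod (t n y) \<le> cmod (h n))" if x: "x \<in> S" for x
  proof -
    define d where "d = Re x / 2"
    have d: "d > 0" using x S by (auto simp: d_def)
    define h where "h n = complex_of_real (B * (norm x + d) * real (Suc n) powr (- d - 1))" for n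
    have "summable (\<lambda>n. real (Suc n) powr (- d - 1))"
      using d by (subst summable_Suc_iff[of "\<lambda>n. real n powr (- d - 1)"]) (simp add: summable_real_powr_iff)
    then have sm: "summable h"
      unfolding h_def by (intro summable_of_real summable_mult)
    have h0: "0 \<le> B * (norm x + d) * real (Suc n) powr (- d - 1)" for n
      using B d by simp
    have "cmod (t n y) \<le> cmod (h n)" if y: "y \<in> ball x d \<inter> S" for n y
    proof -
      have "\<bar>Re x - Re y\<bar> \<le> norm (x - y)" using abs_Re_le_cmod[of "x - y"] by simp
      then have Rey: "Re y \<ge> d" using y unfolding d_def by (auto simp: dist_norm)
      have "norm y \<le> norm x + norm (y - x)" by (metis add.commute diff_add_cancel norm_triangle_ineq)
      then have ny: "norm y \<le> norm x + d" using y by (auto simp: dist_norm norm_minus_commute)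
      have "norm (t n y) \<le> B * norm y * real (Suc n) powr (- Re y - 1)" using bound y by blast
      also have "\<dots> \<le> B * (norm x + d) * real (Suc n) powr (- d - 1)"
        using ny Rey B d by (intro mult_mono mult_left_mono powr_mono) auto
      also have "\<dots> = cmod (h n)" using h0[of n] by (simp only: h_def norm_of_real abs_of_nonneg)
      finally show ?thesis .
    qed
    moreover have "range h \<subseteq> \<real>\<^sub>\<ge>\<^sub>0" unfolding h_def using h0 by (auto simp del: of_real_mult of_nat_Suc)
    ultimately show ?thesis using d sm by (intro exI[of _ d] exI[of _ h]) auto
  qed
  obtain g where g: "\<forall>x\<in>S. ((\<lambda>n. t n x) sums g x) \<and> g field_differentiable (at x)"
  proof (rule series_differentiable_comparison_complex[OF S(1), of t])
    show "t n field_differentiable at x" if "x \<in> S" for n x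
      using hol[of n] that S(1) holomorphic_on_imp_differentiable_at by blast
  qed (use loc in blast)+
  show ?thesis
    by (rule that[of g]) (use g S(1) in \<open>auto simp: holomorphic_on_def intro: field_differentiable_at_within\<close>)
qed

text \<open>Along the segment the derivative has modulus \<open>norm s\<close> times a decreasing
  power of the real variable, hence is largest at \<open>a\<close>.\<close>

lemma norm_powr_diff_le:
  fixes s :: complex and a b :: real
  assumes "0 < a" "a \<le> b" "Re s > 0"
  shows "norm (of_real b powr - s - of_real a powr - s) \<le> norm s * a powr (- Re s - 1) * (b - a)"
proof -
  have "norm (of_real b powr - s - of_real a powr - s)
      \<le> norm s * a powr (- Re s - 1) * norm (complex_of_real b - complex_of_real a)"
  proof (rule field_differentiable_bound[where S = "closed_segment (complex_of_real a) (complex_of_real b)"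
        and f' = "\<lambda>z. - s * z powr (- s - 1)"])
    fix z assume "z \<in> closed_segment (complex_of_real a) (complex_of_real b)"
    then have "z \<in> complex_of_real ` closed_segment a b" by (simp add: closed_segment_of_real)
    then obtain x where x: "z = of_real x" "a \<le> x" using assms by (auto simp: closed_segment_eq_real_ivl)
    have nz: "z \<notin> \<real>\<^sub>\<le>\<^sub>0" using x assms by (auto simp: nonpos_Reals_def)
    then show "((\<lambda>z. z powr - s) has_field_derivative - s * z powr (- s - 1))
        (at z within closed_segment (complex_of_real a) (complex_of_real b))"
      by (rule has_field_derivative_at_within[OF has_field_derivative_powr])
    have "cmod (z powr (- s - 1)) = x powr (- Re s - 1)"
      using x assms by (simp add: norm_powr_real_powr)
    also have "\<dots> \<le> a powr (- Re s - 1)" using x assms by (intro powr_mono2') auto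
    finally show "cmod (- s * z powr (- s - 1)) \<le> norm s * a powr (- Re s - 1)"
      by (simp add: norm_mult mult_left_mono)
  qed auto
  also have "norm (complex_of_real b - complex_of_real a) = b - a"
    using assms by (simp add: of_real_diff[symmetric] del: of_real_diff)
  finally show ?thesis .
qed

lemma of_nat_powr_real:
  "complex_of_nat n powr complex_of_real x = complex_of_real (real n powr x)"
  using powr_of_real[of "real n" x] by simp

lemma norm_of_nat_powr: "norm (complex_of_nat n powr s) = real n powr Re s"
  by (simp add: norm_powr_real_powr)

lemma of_nat_Suc_powr_tendsto_0:
  assumes "Re s > 0"
  shows "(\<lambda>n. complex_of_nat (Suc n) powr - s) \<longlonglongrightarrow> 0"
proof (rule tendsto_norm_zero_cancel)
  have "(\<lambda>n. real (Suc n) powr - Re s) \<longlonglongrightarrow> 0" using assms by real_asymp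
  then show "(\<lambda>n. norm (complex_of_nat (Suc n) powr - s)) \<longlonglongrightarrow> 0"
    by (simp only: norm_of_nat_powr uminus_complex.sel)
qed

section \<open>Continuation of the series of a nonprincipal character to
  \<open>Re s > 0\<close>\<close>

context real_char
begin

text \<open>Summation by parts replaces the conditionally convergent series by one in the bounded
  partial sums \<open>A\<close> and the differences of consecutive powers, which converges
  absolutely; the boundary term tends to 0.\<close>

lemma dirichlet_series_sums_holomorphic:
  obtains g where "g holomorphic_on {s. Re s > 0}"
    "\<And>s. Re s > 0 \<Longrightarrow> (\<lambda>n. complex_of_real (f (Suc n)) * of_nat (Suc n) powr - s) sums g s"
proof -
  define A where "A n = (\<Sum>k\<in>{0<..n}. f k)" for n
  define t where "t n s = complex_of_real (A (Suc n)) * (of_nat (Suc n) powr - s - of_nat (Suc (Suc n)) powr - s)" for n s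
  have A: "\<bar>A n\<bar> \<le> q" for n unfolding A_def by (rule sum_f_atMost_le)
  have bnd: "norm (t n s) \<le> real q * norm s * real (Suc n) powr (- Re s - 1)" if "Re s > 0" for n s
  proof -
    have "norm (of_nat (Suc n) powr - s - of_nat (Suc (Suc n)) powr - s) \<le> norm s * real (Suc n) powr (- Re s - 1)"
      using norm_powr_diff_le[of "real (Suc n)" "real (Suc (Suc n))" s] that
      by (simp add: norm_minus_commute)
    then have "norm (t n s) \<le> real q * (norm s * real (Suc n) powr (- Re s - 1))"
      unfolding t_def norm_mult norm_of_real using A by (intro mult_mono) auto
    then show ?thesis by (simp add: mult.assoc)
  qed
  obtain g where g: "g holomorphic_on {s. Re s > 0}" "\<And>s. Re s > 0 \<Longrightarrow> (\<lambda>n. t n s) sums g s"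
  proof (rule holomorphic_sums_powr_bound[of "{s. Re s > 0}" t "real q"])
    show "open {s. 0 < Re s}" by (rule open_halfspace_Re_gt)
    show "t n holomorphic_on {s. 0 < Re s}" for n
      unfolding t_def by (intro holomorphic_intros)
  qed (use bnd in auto)
  have "(\<lambda>n. complex_of_real (f (Suc n)) * of_nat (Suc n) powr - s) sums g s" if s: "Re s > 0" for s
  proof -
    have part: "(\<Sum>n<N. complex_of_real (f (Suc n)) * of_nat (Suc n) powr - s)
        = (\<Sum>n<N. t n s) + complex_of_real (A N) * of_nat (Suc N) powr - s" for N
    proof (induction N)
      case (Suc N)
      have "{0<..Suc N} = insert (Suc N) {0<..N}" by auto
      then have "A (Suc N) = A N + f (Suc N)" by (simp add: A_def)
      then show ?case using Suc by (simp add: t_def algebra_simps del: of_nat_Suc)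
    qed (simp add: A_def)
    have "(\<lambda>N. complex_of_real (A N) * of_nat (Suc N) powr - s) \<longlonglongrightarrow> 0"
    proof (rule Lim_null_comparison)
      show "\<forall>\<^sub>F N in sequentially. norm (complex_of_real (A N) * of_nat (Suc N) powr - s)
          \<le> real q * norm (complex_of_nat (Suc N) powr - s)"
        unfolding norm_mult norm_of_real using A by (intro always_eventually allI mult_right_mono) auto
      show "(\<lambda>N. real q * norm (complex_of_nat (Suc N) powr - s)) \<longlonglongrightarrow> 0"
        by (intro tendsto_mult_right_zero tendsto_norm_zero of_nat_Suc_powr_tendsto_0 s)
    qed
    then show ?thesis
      unfolding sums_def part using tendsto_add[OF g(2)[OF s, unfolded sums_def]] by fastforce
  qed
  with g(1) that show thesis by blast
qed

lemma dirichlet_L_eq_L: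
  assumes chi: "\<And>n. chi (int n) = complex_of_real (f n)" and "\<not> principal_character q chi"
    and "\<sigma> > 0"
  shows "dirichlet_L q chi (complex_of_real \<sigma>) = complex_of_real (L \<sigma>)"
proof -
  obtain g where g: "g holomorphic_on {s. Re s > 0}"
    "\<And>s. Re s > 0 \<Longrightarrow> (\<lambda>n. complex_of_real (f (Suc n)) * of_nat (Suc n) powr - s) sums g s"
    using dirichlet_series_sums_holomorphic by blast
  have dom: "dirichlet_L_domain q chi 0 = {s. Re s > 0}"
    using assms by (simp add: dirichlet_L_domain_def)
  have "dirichlet_L q chi (complex_of_real \<sigma>) = g \<sigma>"
  proof (rule dirichlet_L_eqI[of _ _ _ 0])
    fix z :: complex assume "Re z > 1"
    then have "(\<lambda>n. complex_of_real (f (Suc n)) * of_nat (Suc n) powr - z) sums g z" by (intro g) auto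
    then have "(\<lambda>n. chi (int (Suc n)) / of_nat (Suc n) powr z) sums g z"
      by (simp only: chi powr_minus divide_inverse)
    then show "g z = dirichlet_L_series chi z"
      unfolding dirichlet_L_series_def by (simp add: sums_iff)
  qed (use g assms dom in auto)
  moreover have "g \<sigma> = of_real (L \<sigma>)"
  proof (rule LIMSEQ_unique)
    show "(\<lambda>N. \<Sum>n<N. complex_of_real (f (Suc n)) * of_nat (Suc n) powr - of_real \<sigma>) \<longlonglongrightarrow> g \<sigma>"
      using g(2)[of "of_real \<sigma>"] assms by (simp add: sums_def)
    have "(\<Sum>n<N. complex_of_real (f (Suc n)) * of_nat (Suc n) powr - of_real \<sigma>)
        = of_real (\<Sum>n\<in>{0<..N}. f n * real n powr - \<sigma>)" for N
    proof -
      have "(\<Sum>n<N. complex_of_real (f (Suc n)) * of_nat (Suc n) powr - of_real \<sigma>)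
          = of_real (\<Sum>n<N. f (Suc n) * real (Suc n) powr - \<sigma>)"
        using of_nat_powr_real[of _ "- \<sigma>"] by (simp del: of_nat_Suc)
      also have "(\<Sum>n<N. f (Suc n) * real (Suc n) powr - \<sigma>) = (\<Sum>n\<in>{0<..N}. f n * real n powr - \<sigma>)"
        by (rule sum.reindex_bij_witness[of _ "\<lambda>n. n - 1" Suc]) auto
      finally show ?thesis .
    qed
    then show "(\<lambda>N. \<Sum>n<N. complex_of_real (f (Suc n)) * of_nat (Suc n) powr - of_real \<sigma>) \<longlonglongrightarrow> of_real (L \<sigma>)"
      using L_tendsto[OF assms(3)] by (simp only: tendsto_of_real_iff)
  qed
  ultimately show ?thesis by simp
qed

end

text \<open>The function \<open>Z\<close> is the Riemann zeta function.\<close>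
lemma zeta_continuation:
  obtains Z :: "complex \<Rightarrow> complex" where "Z holomorphic_on {s. Re s > 0} - {1}"
    "\<And>s. Re s > 1 \<Longrightarrow> (\<lambda>n. of_nat (Suc n) powr - s) sums Z s"
    "\<And>\<delta>. 0 < \<delta> \<Longrightarrow> \<delta> < 1 \<Longrightarrow> Z (complex_of_real (1 - \<delta>)) \<noteq> 0"
proof -
  let ?S = "{s. Re s > 0} - {1 :: complex}"
  \<comment> \<open>This is a term of the zeta series minus the integral of the same power over the
    following unit interval. The integrals telescope and account for the pole term
    \<open>1 / (s - 1)\<close>.\<close>
  define t where "t n s = of_nat (Suc n) powr - s
    - (of_nat (Suc (Suc n)) powr (1 - s) - of_nat (Suc n) powr (1 - s)) / (1 - s)" for n and s :: complex
  have bnd: "norm (t n s) \<le> 1 * norm s * real (Suc n) powr (- Re s - 1)" if s: "s \<in> ?S" for n s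
  proof -
    let ?a = "real (Suc n)" and ?b = "real (Suc (Suc n))"
    \<comment> \<open>An antiderivative of \<open>a powr - s - z powr - s\<close>: its increment
      from \<open>a\<close> to \<open>b\<close> is \<open>t n s\<close>, and the integrand is small
      since \<open>b - a = 1\<close>.\<close>
    let ?h = "\<lambda>z. z * of_real ?a powr - s - z powr (1 - s) / (1 - s)"
    have "norm (?h (of_real ?b) - ?h (of_real ?a))
        \<le> norm s * ?a powr (- Re s - 1) * norm (complex_of_real ?b - complex_of_real ?a)"
    proof (rule field_differentiable_bound[where S = "closed_segment (complex_of_real ?a) (complex_of_real ?b)"
          and f' = "\<lambda>z. of_real ?a powr - s - z powr - s"])
      fix z assume "z \<in> closed_segment (complex_of_real ?a) (complex_of_real ?b)"
      then have "z \<in> complex_of_real ` closed_segment ?a ?b" by (simp only: closed_segment_of_real)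
      then obtain x where x: "z = of_real x" "?a \<le> x" "x \<le> ?b"
        by (auto simp: closed_segment_eq_real_ivl)
      have nz: "z \<notin> \<real>\<^sub>\<le>\<^sub>0" using x by (auto simp: nonpos_Reals_def)
      have "((\<lambda>z. z powr (1 - s)) has_field_derivative (1 - s) * z powr (1 - s - 1)) (at z)"
        using nz by (rule has_field_derivative_powr)
      then show "(?h has_field_derivative of_real ?a powr - s - z powr - s)
          (at z within closed_segment (complex_of_real ?a) (complex_of_real ?b))"
        using s nz by (intro DERIV_subset[where s = UNIV and t = "closed_segment _ _"]) (auto intro!: derivative_eq_intros)
      have "norm (of_real x powr - s - of_real ?a powr - s) \<le> norm s * ?a powr (- Re s - 1) * (x - ?a)"
        using s x by (intro norm_powr_diff_le) auto
      also have "\<dots> \<le> norm s * ?a powr (- Re s - 1) * 1"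
        using x by (intro mult_left_mono) auto
      finally show "cmod (of_real ?a powr - s - z powr - s) \<le> norm s * ?a powr (- Re s - 1)"
        by (simp only: x norm_minus_commute mult_1_right)
    qed auto
    moreover have "?h (of_real ?b) - ?h (of_real ?a) = t n s"
      by (simp add: t_def algebra_simps diff_divide_distrib)
    moreover have "norm (complex_of_real ?b - complex_of_real ?a) = 1" by simp
    ultimately show ?thesis by simp
  qed
  obtain g where g: "g holomorphic_on ?S" "\<And>s. s \<in> ?S \<Longrightarrow> (\<lambda>n. t n s) sums g s"
  proof (rule holomorphic_sums_powr_bound[of ?S t 1])
    show "open ?S" by (intro open_Diff open_halfspace_Re_gt) auto
    show "t n holomorphic_on ?S" for n
      unfolding t_def by (intro holomorphic_intros) auto
  qed (use bnd in auto)
  define Z where "Z s = g s + 1 / (s - 1)" for s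
  have part: "(\<Sum>n<N. t n s) = (\<Sum>n<N. of_nat (Suc n) powr - s) - (of_nat (Suc N) powr (1 - s) - 1) / (1 - s)" for N s
  proof (induction N)
    case (Suc N)
    then show ?case by (simp add: t_def diff_divide_distrib del: of_nat_Suc)
  qed simp
  have Zlim: "(\<lambda>N. (\<Sum>n<N. of_nat (Suc n) powr - s) - of_nat (Suc N) powr (1 - s) / (1 - s)) \<longlonglongrightarrow> Z s"
    if s: "s \<in> ?S" for s
  proof -
    have "(\<lambda>N. (\<Sum>n<N. t n s) + 1 / (s - 1)) \<longlonglongrightarrow> Z s"
      unfolding Z_def using g(2)[OF s] by (intro tendsto_intros) (simp add: sums_def)
    moreover have "1 / (s - 1) = - (1 / (1 - s))"
      by (metis minus_diff_eq minus_divide_right)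
    ultimately show ?thesis by (simp add: part diff_divide_distrib)
  qed
  show ?thesis
  proof (rule that[of Z])
    show "Z holomorphic_on ?S" unfolding Z_def using g(1) by (intro holomorphic_intros) auto
  next
    fix s :: complex assume s: "Re s > 1"
    then have "s \<noteq> 1" by auto
    have "(\<lambda>N. of_nat (Suc N) powr - (s - 1) / (1 - s)) \<longlonglongrightarrow> 0 / (1 - s)"
      using s by (intro tendsto_intros of_nat_Suc_powr_tendsto_0) auto
    from tendsto_add[OF Zlim[of s] this]
    show "(\<lambda>n. of_nat (Suc n) powr - s) sums Z s" using s \<open>s \<noteq> 1\<close> by (simp add: sums_def)
  next
    fix \<delta> :: real assume \<delta>: "0 < \<delta>" "\<delta> < 1"
    obtain C where C: "C \<le> 1 - 1 / \<delta>"
      "(\<lambda>n. (\<Sum>e\<in>{0<..n}. real e powr (\<delta> - 1)) - real n powr \<delta> / \<delta>) \<longlonglongrightarrow> C"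
      using zeta_partial_sum[OF \<delta>] by metis
    \<comment> \<open>\<open>Zlim\<close> compares the sum of \<open>N\<close> terms with the power
      of \<open>N + 1\<close>, whereas \<open>C\<close> is defined with the power of
      \<open>N\<close>; the difference vanishes in the limit.\<close>
    have "(\<lambda>n. (real (Suc n) powr \<delta> - real n powr \<delta>) / \<delta>) \<longlonglongrightarrow> 0" using \<delta> by real_asymp
    from tendsto_diff[OF C(2) this]
    have lim: "(\<lambda>n. (\<Sum>e\<in>{0<..n}. real e powr (\<delta> - 1)) - real (Suc n) powr \<delta> / \<delta>) \<longlonglongrightarrow> C"
      by (simp add: diff_divide_distrib)
    have "Z (complex_of_real (1 - \<delta>)) = of_real C"
    proof (rule LIMSEQ_unique)
      let ?s = "complex_of_real (1 - \<delta>)"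
      show "(\<lambda>N. (\<Sum>n<N. of_nat (Suc n) powr - ?s) - of_nat (Suc N) powr (1 - ?s) / (1 - ?s)) \<longlonglongrightarrow> Z ?s"
        by (rule Zlim) (use \<delta> in \<open>auto simp: complex_eq_iff\<close>)
      have "(\<Sum>n<N. of_nat (Suc n) powr - ?s) - of_nat (Suc N) powr (1 - ?s) / (1 - ?s)
          = of_real ((\<Sum>e\<in>{0<..N}. real e powr (\<delta> - 1)) - real (Suc N) powr \<delta> / \<delta>)" for N
      proof -
        have "(\<Sum>e\<in>{0<..N}. real e powr (\<delta> - 1)) = (\<Sum>n<N. real (Suc n) powr (\<delta> - 1))"
          by (rule sum.reindex_bij_witness[of _ Suc "\<lambda>n. n - 1"]) auto
        moreover have "(\<Sum>n<N. of_nat (Suc n) powr - ?s) = of_real (\<Sum>n<N. real (Suc n) powr (\<delta> - 1))"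
          using of_nat_powr_real[of _ "\<delta> - 1"] by (simp del: of_nat_Suc)
        moreover have "of_nat (Suc N) powr (1 - ?s) / (1 - ?s) = of_real (real (Suc N) powr \<delta> / \<delta>)"
          using of_nat_powr_real[of "Suc N" \<delta>] by (simp del: of_nat_Suc)
        ultimately show ?thesis by (simp only: of_real_diff)
      qed
      then show "(\<lambda>N. (\<Sum>n<N. of_nat (Suc n) powr - ?s) - of_nat (Suc N) powr (1 - ?s) / (1 - ?s)) \<longlonglongrightarrow> of_real C"
        using lim by (simp only: tendsto_of_real_iff)
    qed
    \<comment> \<open>The upper bound \<open>1 - 1 / \<delta>\<close> is negative, which is why zeta
      has no zero here.\<close>
    moreover have "C < 0" using C(1) \<delta> by (smt (verit) less_divide_eq_1_pos)
    ultimately show "Z (complex_of_real (1 - \<delta>)) \<noteq> 0" by simp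
  qed
qed

section \<open>Principal characters as zeta times a finite Euler product\<close>

lemma coprime_series_sums:
  fixes s Z :: complex
  assumes "finite P" "\<And>p. p \<in> P \<Longrightarrow> prime p"
    and Z: "(\<lambda>n. of_nat n powr - s) sums Z"
  shows "(\<lambda>n. if \<exists>p\<in>P. p dvd n then 0 else of_nat n powr - s) sums ((\<Prod>p\<in>P. 1 - of_nat p powr - s) * Z)"
  using assms(1,2)
proof (induction P rule: finite_induct)
  case empty
  then show ?case using Z by simp
next
  case (insert p P)
  define a where "a n = (if \<exists>r\<in>P. r dvd n then 0 else of_nat n powr - s)" for n
  define Y where "Y = (\<Prod>p\<in>P. 1 - of_nat p powr - s) * Z"
  have a: "a sums Y" using insert unfolding a_def[abs_def] Y_def by auto
  have p: "prime p" using insert by auto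
  \<comment> \<open>Divisibility by the primes in \<open>P\<close> ignores the new prime
    \<open>p\<close>, so the terms at multiples of \<open>p\<close> form a copy of the series scaled
    by \<open>p powr - s\<close>. Subtracting it removes them. The index 0 is harmless because
    \<open>0 powr - s\<close> is 0.\<close>
  have apm: "a (p * m) = of_nat p powr - s * a m" for m
  proof -
    have "r dvd p * m \<longleftrightarrow> r dvd m" if "r \<in> P" for r
      using that insert p by (metis insertCI prime_dvd_mult_iff primes_dvd_imp_eq dvd_mult)
    then show ?thesis by (auto simp: a_def powr_times_real)
  qed
  have "(\<lambda>m. of_nat p powr - s * a m) sums (of_nat p powr - s * Y)"
    using a by (rule sums_mult)
  then have "(\<lambda>m. (if p dvd p * m then a (p * m) else 0)) sums (of_nat p powr - s * Y)"
    by (simp add: apm)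
  moreover have "strict_mono (\<lambda>m. p * m)" using p prime_gt_0_nat by (auto simp: strict_mono_def)
  then have "(\<lambda>m. if p dvd p * m then a (p * m) else 0) sums (of_nat p powr - s * Y)
      \<longleftrightarrow> (\<lambda>n. if p dvd n then a n else 0) sums (of_nat p powr - s * Y)"
    by (rule sums_mono_reindex) (auto simp: dvd_def)
  ultimately have "(\<lambda>n. if p dvd n then a n else 0) sums (of_nat p powr - s * Y)" by blast
  from sums_diff[OF a this]
  have "(\<lambda>n. a n - (if p dvd n then a n else 0)) sums ((1 - of_nat p powr - s) * Y)"
    by (simp add: algebra_simps)
  moreover have "(\<lambda>n. a n - (if p dvd n then a n else 0))
      = (\<lambda>n. if \<exists>r\<in>insert p P. r dvd n then 0 else of_nat n powr - s)"
    by (auto simp: a_def fun_eq_iff)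
  ultimately show ?case using insert by (simp add: Y_def mult.assoc)
qed

lemma not_coprime_iff_prime_factor:
  assumes "(q::nat) > 0"
  shows "\<not> coprime n q \<longleftrightarrow> (\<exists>p\<in>prime_factors q. p dvd n)"
proof
  assume "\<not> coprime n q"
  then have "gcd n q \<noteq> 1" unfolding coprime_iff_gcd_eq_1 .
  then obtain p where "prime p" "p dvd gcd n q" using prime_factor_nat by blast
  then show "\<exists>p\<in>prime_factors q. p dvd n" using assms by (auto simp: in_prime_factors_iff)
next
  assume "\<exists>p\<in>prime_factors q. p dvd n"
  then obtain p where "prime p" "p dvd q" "p dvd n" by (auto simp: in_prime_factors_iff)
  then show "\<not> coprime n q" using not_prime_unit coprime_common_divisor by blast
qed

lemma dirichlet_L_principal_nonzero:
  assumes chi: "dirichlet_character q chi" "principal_character q chi" and \<delta>: "0 < \<delta>" "\<delta> < 1"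
  shows "dirichlet_L q chi (complex_of_real (1 - \<delta>)) \<noteq> 0"
proof -
  have "q > 0" using chi by (simp add: dirichlet_character_def)
  obtain Z where Z: "Z holomorphic_on {s. Re s > 0} - {1}"
    "\<And>s. Re s > 1 \<Longrightarrow> (\<lambda>n. of_nat (Suc n) powr - s) sums Z s"
    "Z (complex_of_real (1 - \<delta>)) \<noteq> 0"
    using zeta_continuation \<delta> by metis
  define F where "F s = (\<Prod>p\<in>prime_factors q. 1 - of_nat p powr - s) * Z s" for s
  have dom: "dirichlet_L_domain q chi 0 = {s. Re s > 0} - {1}"
    using chi by (simp add: dirichlet_L_domain_def)
  have "dirichlet_L q chi (complex_of_real (1 - \<delta>)) = F (complex_of_real (1 - \<delta>))"
  proof (rule dirichlet_L_eqI[of _ _ _ 0])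
    show "complex_of_real (1 - \<delta>) \<in> dirichlet_L_domain q chi 0"
      unfolding dom using \<delta> by (auto simp: complex_eq_iff)
    show "F holomorphic_on dirichlet_L_domain q chi 0"
      unfolding dom F_def using Z(1)
      by (intro holomorphic_intros) (auto simp: in_prime_factors_iff)
  next
    fix z :: complex assume z: "Re z > 1"
    have zeta: "(\<lambda>n. of_nat n powr - z) sums Z z"
      using Z(2)[OF z] sums_Suc[of "\<lambda>n. of_nat n powr - z"] by simp
    define c where "c n = (if \<exists>p\<in>prime_factors q. p dvd n then 0 else complex_of_nat n powr - z)" for n
    have "c sums F z"
      unfolding F_def c_def[abs_def]
      by (rule coprime_series_sums) (use zeta in \<open>auto simp: in_prime_factors_iff\<close>)
    moreover have "c 0 = 0" by (simp add: c_def)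
    ultimately have "(\<lambda>n. c (Suc n)) sums F z" by (subst sums_Suc_iff) simp
    moreover have "c (Suc n) = chi (int (Suc n)) / of_nat (Suc n) powr z" for n
    proof -
      have "chi (int (Suc n)) = (if coprime (Suc n) q then 1 else 0)"
        using chi unfolding dirichlet_character_def principal_character_def
        by (metis coprime_int_iff)
      then show ?thesis
        using not_coprime_iff_prime_factor[OF \<open>q > 0\<close>, of "Suc n"] by (auto simp: c_def powr_minus divide_inverse)
    qed
    ultimately show "F z = dirichlet_L_series chi z"
      unfolding dirichlet_L_series_def by (simp add: sums_iff)
  qed
  moreover have "1 - of_nat p powr - complex_of_real (1 - \<delta>) \<noteq> 0" if "p \<in> prime_factors q" for p
  proof -
    have "real p > 1" using that prime_gt_1_nat by (auto simp: in_prime_factors_iff)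
    then have "real p powr - (1 - \<delta>) < 1" using \<delta> by (intro powr_less_one) auto
    moreover have "of_nat p powr - complex_of_real (1 - \<delta>) = of_real (real p powr - (1 - \<delta>))"
      using of_nat_powr_real[of p "- (1 - \<delta>)"] by simp
    ultimately show ?thesis by (simp only: right_minus_eq) (metis less_irrefl of_real_eq_1_iff)
  qed
  ultimately show ?thesis using Z(3) by (simp add: F_def)
qed

text \<open>By Euler's theorem a nonzero value is a root of unity, and a real one is 1 or -1. A
  nonprincipal character differs from 1 at some unit, where it must then equal -1.\<close>

lemma real_char_of_dirichlet_character:
  assumes chi: "dirichlet_character q chi" "real_character chi" "\<not> principal_character q chi"
  shows "real_char q (\<lambda>n. Re (chi (int n)))" and "chi (int n) = complex_of_real (Re (chi (int n)))"
proof -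
  have q: "q > 0" and mult: "chi (m * n) = chi m * chi n" and per: "chi (n + int q) = chi n"
    and nz: "chi n \<noteq> 0 \<longleftrightarrow> coprime n (int q)" for m n
    using chi unfolding dirichlet_character_def by blast+
  have re: "chi n = of_real (Re (chi n))" for n
    using chi(2) by (simp add: real_character_def)
  then show "chi (int n) = complex_of_real (Re (chi (int n)))" .
  have perk: "chi (n + int k * int q) = chi n" for n k
  proof (induction k)
    case (Suc k)
    then show ?case using per[of "n + int k * int q"] by (simp add: algebra_simps)
  qed simp
  \<comment> \<open>Every value is already taken at a natural number, so restricting to naturals
    keeps the witness of value -1.\<close>
  have modq: "chi (int (nat (n mod int q))) = chi n" for n
  proof (cases "n \<ge> 0")
    case True
    then show ?thesis using perk[of "n mod int q" "nat (n div int q)"] q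
      by (simp add: pos_imp_zdiv_nonneg_iff)
  next
    case False
    then have "n div int q \<le> 0" using q by (simp add: div_nonpos_pos_le0)
    then have "n + int (nat (- (n div int q))) * int q = n mod int q"
      by (simp add: minus_div_mult_eq_mod[symmetric])
    then show ?thesis using perk[of n "nat (- (n div int q))"] q by simp
  qed
  have one: "chi 1 = 1"
  proof -
    have "chi 1 \<noteq> 0" by (simp add: nz)
    then show ?thesis using mult[of 1 1] by simp
  qed
  have pow: "chi (n ^ k) = chi n ^ k" for n k by (induction k) (simp_all add: one mult)
  have vals: "Re (chi n) \<in> {-1, 0, 1}" for n
  proof (cases "chi n = 0")
    case False
    define m where "m = nat (n mod int q)"
    have m: "chi (int m) = chi n" unfolding m_def by (rule modq)
    then have "coprime m q" using False nz[of "int m"] by (simp add: coprime_int_iff)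
    then have "[m ^ totient q = 1] (mod q)" by (rule euler_theorem)
    then have "chi (int (m ^ totient q)) = chi (int 1)"
      by (metis cong_def modq of_nat_mod nat_int)
    then have "chi n ^ totient q = 1" by (simp add: pow m one)
    then have "norm (chi n) = 1" using q by (metis power_eq_1_iff totient_gt_0_iff less_irrefl)
    then have "\<bar>Re (chi n)\<bar> = 1" by (subst (asm) re) (simp only: norm_of_real)
    then show ?thesis by auto
  qed auto
  have zero: "Re (chi n) = 0 \<longleftrightarrow> chi n = 0" for n by (metis re of_real_0 zero_complex.sel(1))
  show "real_char q (\<lambda>n. Re (chi (int n)))"
  proof
    show "q > 0" by (rule q)
    show "Re (chi (int (m * n))) = Re (chi (int m)) * Re (chi (int n))" for m n
    proof -
      have "chi (int (m * n)) = of_real (Re (chi (int m)) * Re (chi (int n)))"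
        by (metis mult of_nat_mult of_real_mult re)
      then show ?thesis by simp
    qed
    show "Re (chi (int (n + q))) = Re (chi (int n))" for n by (simp add: per)
    show "Re (chi (int n)) \<noteq> 0 \<longleftrightarrow> coprime n q" for n using nz[of "int n"] zero[of "int n"] by simp
    show "Re (chi (int n)) \<in> {-1, 0, 1}" for n by (rule vals)
    obtain n where n: "coprime n (int q)" "chi n \<noteq> 1"
      using chi(3) by (auto simp: principal_character_def)
    have "Re (chi n) \<noteq> 0" using n nz zero by blast
    moreover have "Re (chi n) \<noteq> 1" using n by (metis of_real_1 re)
    ultimately have "Re (chi n) = -1" using vals[of n] by auto
    then have "Re (chi (int (nat (n mod int q)))) = -1" by (simp only: modq)
    then show "\<exists>n. Re (chi (int n)) = -1" by blast
  qed
qed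

subsection \<open>Sieving an interval\<close>

text \<open>Among the \<open>p\<close> classes one contains at least the average share of what is
  left; removing it costs a factor \<open>1 - 1 / p\<close> for every prime in turn.\<close>

lemma greedy_residues:
  fixes S :: "int set"
  assumes "finite S" "finite P" "\<And>p. p \<in> P \<Longrightarrow> p > 0"
  shows "\<exists>b. real (card (S - (\<Union>p\<in>P. {n. [n = b p] (mod int p)})))
    \<le> real (card S) * (\<Prod>p\<in>P. 1 - 1 / real p)"
  using assms(2,3)
proof (induction P rule: finite_induct)
  case (insert p P)
  then obtain b where b: "real (card (S - (\<Union>p\<in>P. {n. [n = b p] (mod int p)})))
    \<le> real (card S) * (\<Prod>p\<in>P. 1 - 1 / real p)" by auto
  define S' where "S' = S - (\<Union>p\<in>P. {n. [n = b p] (mod int p)})"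
  have fin: "finite S'" using assms(1) by (simp add: S'_def)
  have p: "p > 0" using insert by auto
  define C where "C r = {n\<in>S'. n mod int p = r}" for r
  have "S' = (\<Union>r\<in>{0..<int p}. C r)" using p by (auto simp: C_def)
  then have "card S' = card (\<Union>r\<in>{0..<int p}. C r)" by simp
  also have "\<dots> = (\<Sum>r\<in>{0..<int p}. card (C r))"
    using fin by (intro card_UN_disjoint) (auto simp: C_def)
  finally have sum: "card S' = (\<Sum>r\<in>{0..<int p}. card (C r))" .
  have "\<exists>r\<in>{0..<int p}. real (card S') / real p \<le> real (card (C r))"
  proof (rule ccontr)
    assume "\<not> ?thesis"
    then have "(\<Sum>r\<in>{0..<int p}. real (card (C r))) < (\<Sum>r\<in>{0..<int p}. real (card S') / real p)"
      using p by (intro sum_strict_mono) (auto simp: not_le)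
    also have "\<dots> = real (card S')" using p by simp
    finally show False using sum by simp
  qed
  then obtain r where r: "r \<in> {0..<int p}" "real (card S') / real p \<le> real (card (C r))" by blast
  define b' where "b' = b(p := r)"
  have "S - (\<Union>p\<in>insert p P. {n. [n = b' p] (mod int p)}) = S' - C r"
    using insert.hyps r by (auto simp: S'_def C_def b'_def cong_def)
  moreover have "real (card (S' - C r)) = real (card S') - real (card (C r))"
    using fin by (subst card_Diff_subset) (auto simp: C_def intro!: of_nat_diff card_mono)
  moreover have "\<dots> \<le> real (card S') * (1 - 1 / real p)" using r by (simp add: algebra_simps)
  moreover have "\<dots> \<le> real (card S) * (\<Prod>p\<in>P. 1 - 1 / real p) * (1 - 1 / real p)"
    using b p by (intro mult_right_mono) (auto simp: S'_def field_simps)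
  ultimately have "real (card (S - (\<Union>p\<in>insert p P. {n. [n = b' p] (mod int p)})))
      \<le> real (card S) * (\<Prod>p\<in>insert p P. 1 - 1 / real p)"
    using insert.hyps by (simp add: mult_ac)
  then show ?case by blast
qed (use assms(1) in auto)

lemma W_le:
  "W y \<le> card ({n. 0 \<le> real_of_int n \<and> real_of_int n \<le> y} \<inter> sifted_set (sqrt (y / ln y)) a)"
  unfolding W_def by (rule cINF_lower) auto

text \<open>For a prime not dividing \<open>Q\<close> the class removed is the solution of
  \<open>Q * n + a \<equiv> 0\<close>; the primes dividing \<open>Q\<close> are left for the greedy
  choice, whose factors multiply to the totient ratio. The bound on \<open>Q\<close> guarantees that
  these primes belong to the sieve.\<close>

lemma W_le_progression:
  fixes Q a :: nat
  assumes "Q > 0" "real Q \<le> sqrt (y / ln y)"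
  defines "T \<equiv> {n::int. 0 \<le> n \<and> real_of_int n \<le> y \<and>
      (\<forall>p. prime p \<and> real p \<le> sqrt (y / ln y) \<and> \<not> p dvd Q \<longrightarrow> \<not> int p dvd int Q * n + int a)}"
  shows "real (W y) \<le> real (card T) * (real (totient Q) / real Q)"
proof -
  define z where "z = sqrt (y / ln y)"
  have finT: "finite T"
    by (rule finite_subset[of _ "{0..\<lfloor>y\<rfloor>}"]) (auto simp: T_def le_floor_iff)
  obtain b where b: "real (card (T - (\<Union>p\<in>prime_factors Q. {n. [n = b p] (mod int p)})))
      \<le> real (card T) * (\<Prod>p\<in>prime_factors Q. 1 - 1 / real p)"
    using greedy_residues[OF finT finite_set_mset, of "prime_factorization Q"]
      prime_gt_0_nat[OF in_prime_factors_imp_prime[of _ Q]] by blast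
  have "\<exists>x. [int Q * x + int a = 0] (mod int p)" if "prime p" "\<not> p dvd Q" for p
  proof -
    have "coprime p Q" using that prime_imp_coprime by blast
    then have "coprime (int Q) (int p)" by (simp add: coprime_commute)
    then obtain x where "[int Q * x = 1] (mod int p)" using cong_solve_coprime_int by blast
    then have "[int Q * x * (- int a) = 1 * (- int a)] (mod int p)" by (rule cong_scalar_right)
    then have "[int Q * (x * (- int a)) + int a = - int a + int a] (mod int p)"
      by (intro cong_add) (simp_all add: mult.assoc)
    then show ?thesis by (intro exI[of _ "x * (- int a)"]) simp
  qed
  then obtain x where x: "\<And>p. prime p \<Longrightarrow> \<not> p dvd Q \<Longrightarrow> [int Q * x p + int a = 0] (mod int p)"
    by metis
  define r where "r p = (if p dvd Q then b p else x p)" for p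
  have "{n. 0 \<le> real_of_int n \<and> real_of_int n \<le> y} \<inter> sifted_set z r
      \<subseteq> T - (\<Union>p\<in>prime_factors Q. {n. [n = b p] (mod int p)})"
  proof
    fix n assume n: "n \<in> {n. 0 \<le> real_of_int n \<and> real_of_int n \<le> y} \<inter> sifted_set z r"
    then have nr: "\<not> [n = r p] (mod int p)" if "prime p" "real p \<le> z" for p
      using that by (auto simp: sifted_set_def)
    have "\<not> [n = b p] (mod int p)" if p: "p \<in> prime_factors Q" for p
    proof -
      have p': "prime p" "p dvd Q" using p by (auto simp: in_prime_factors_iff)
      then have "p \<le> Q" using assms(1) dvd_imp_le by blast
      then have "real p \<le> z" using assms(2) unfolding z_def by linarith
      then show ?thesis using nr[of p] p' by (simp add: r_def)
    qed
    moreover have "\<not> int p dvd int Q * n + int a" if p: "prime p" "real p \<le> z" "\<not> p dvd Q" for p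
    proof
      assume "int p dvd int Q * n + int a"
      then have "[int Q * n + int a = int Q * x p + int a] (mod int p)"
        using x[OF p(1,3)] by (metis cong_0_iff cong_sym cong_trans)
      then have "[int Q * n = int Q * x p] (mod int p)" by (simp add: cong_add_rcancel)
      moreover have "coprime p Q" using p prime_imp_coprime by blast
      then have "coprime (int Q) (int p)" by (simp add: coprime_commute)
      ultimately have "[n = x p] (mod int p)" using cong_mult_lcancel by blast
      then show False using nr[OF p(1,2)] p(3) by (simp add: r_def)
    qed
    ultimately show "n \<in> T - (\<Union>p\<in>prime_factors Q. {n. [n = b p] (mod int p)})"
      using n unfolding T_def z_def[symmetric] by auto
  qed
  then have "card ({n. 0 \<le> real_of_int n \<and> real_of_int n \<le> y} \<inter> sifted_set z r)
      \<le> card (T - (\<Union>p\<in>prime_factors Q. {n. [n = b p] (mod int p)}))"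
    using finT by (intro card_mono) auto
  then have "W y \<le> card (T - (\<Union>p\<in>prime_factors Q. {n. [n = b p] (mod int p)}))"
    using W_le[of y r] unfolding z_def by linarith
  then have "real (W y) \<le> real (card T) * (\<Prod>p\<in>prime_factors Q. 1 - 1 / real p)"
    using b by linarith
  also have "(\<Prod>p\<in>prime_factors Q. 1 - 1 / real p) = real (totient Q) / real Q"
    using totient_formula2[of Q] assms(1) by simp
  finally show ?thesis .
qed

text \<open>A third prime factor would already force \<open>v\<close> to be at least
  \<open>z ^ 3\<close>.\<close>

lemma rough_number_cases:
  assumes v: "0 < v" "real v < z ^ 3" "z > 1" and rough: "\<And>p. prime p \<Longrightarrow> p dvd v \<Longrightarrow> real p > z"
  shows "v = 1 \<or> prime v \<or> (\<exists>p r. prime p \<and> prime r \<and> z < real p \<and> p \<le> r \<and> v = p * r)"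
proof -
  consider "v = 1" | p where "prime p" "p dvd v" using prime_factor_nat by blast
  then show ?thesis
  proof cases
    case 2
    then obtain w where w: "v = p * w" by blast
    consider "w = 1" | r where "prime r" "r dvd w" using prime_factor_nat by blast
    then show ?thesis
    proof cases
      case 1
      with w 2 show ?thesis by simp
    next
      case (2 r)
      then obtain x where x: "w = r * x" by blast
      have pz: "real p > z" and rz: "real r > z"
        using rough \<open>prime p\<close> \<open>prime r\<close> by (simp_all add: w x)
      have "x = 1"
      proof (rule ccontr)
        assume "x \<noteq> 1"
        then obtain s where s: "prime s" "s dvd x" using prime_factor_nat by blast
        have "real s > z" using rough s by (simp add: w x)
        moreover have "x > 0" using v by (auto simp: w x intro: Nat.gr0I)
        then have "s \<le> x" using s by (simp add: dvd_imp_le)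
        ultimately have "real x > z" by linarith
        then have "z * (z * z) \<le> real p * (real r * real x)"
          using pz rz v(3) by (intro mult_mono) auto
        also have "\<dots> = real v" by (simp add: w x)
        finally show False using v(2) by (simp add: power3_eq_cube)
      qed
      then have "v = p * r" "v = r * p" using w x by simp_all
      then show ?thesis using \<open>prime p\<close> \<open>prime r\<close> pz rz by (metis nat_le_linear)
    qed
  qed simp
qed

context real_char
begin

text \<open>A witness \<open>a\<close> of value -1 is coprime to \<open>q\<close> but may share
  primes with \<open>Q\<close>. Adding \<open>q\<close> times the product \<open>R\<close> of the
  primes of \<open>Q\<close> dividing neither \<open>q\<close> nor \<open>a\<close> keeps the value:
  a prime of \<open>Q\<close> then divides exactly one of the two summands.\<close>

lemma exists_coprime_f_minus_1:
  assumes "Q > 0" "q dvd Q"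
  obtains u where "coprime u Q" "f u = -1"
proof -
  obtain a where a: "f a = -1" using nonprincipal by blast
  then have cop: "coprime a q" using nonzero_iff[of a] by simp
  define R where "R = {p\<in>prime_factors Q. \<not> p dvd q \<and> \<not> p dvd a}"
  define u where "u = a + \<Prod>R * q"
  have R: "finite R" "\<And>p. p \<in> R \<Longrightarrow> prime p" by (auto simp: R_def in_prime_factors_iff)
  have "\<not> p dvd u" if p: "p \<in> prime_factors Q" for p
  proof -
    have pp: "prime p" using p by (simp add: in_prime_factors_iff)
    consider "p dvd q" | "\<not> p dvd q" "p dvd a" | "p \<in> R" using p by (auto simp: R_def)
    then show ?thesis
    proof cases
      case 1
      then have "\<not> p dvd a" using cop pp coprime_common_divisor not_prime_unit by blast
      then show ?thesis using 1 by (simp add: u_def dvd_add_left_iff)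
    next
      case 2
      have "\<not> p dvd \<Prod>R"
      proof
        assume "p dvd \<Prod>R"
        then obtain r where "r \<in> R" "p dvd r" using prime_dvd_prod_iff[OF R(1) pp, of "\<lambda>x. x"] by auto
        then have "p \<in> R" using R(2) pp primes_dvd_imp_eq by blast
        then show False using 2 by (simp add: R_def)
      qed
      then show ?thesis using 2 pp by (simp add: u_def dvd_add_right_iff prime_dvd_mult_iff)
    next
      case 3
      then have "p dvd \<Prod>R * q" using R(1) by (intro dvd_mult2 dvd_prodI[of R _ "\<lambda>x. x", simplified]) auto
      then show ?thesis using 3 by (simp add: u_def dvd_add_left_iff R_def)
    qed
  qed
  then have "coprime u Q" using not_coprime_iff_prime_factor[OF assms(1)] by blast
  moreover have "f u = -1" using a by (simp add: u_def f_add_mult)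
  ultimately show thesis by (rule that)
qed

text \<open>Multiplication by a unit \<open>u\<close> modulo \<open>Q\<close> with
  \<open>f u = -1\<close> maps the units of value -1 injectively to those of value 1.\<close>

lemma totient_le_card_f_eq_1:
  assumes "Q > 1" "q dvd Q"
  shows "totient Q \<le> 2 * card {a. a < Q \<and> coprime a Q \<and> f a = 1}"
proof -
  let ?R = "{a. a < Q \<and> coprime a Q \<and> f a = 1}" and ?R' = "{a. a < Q \<and> coprime a Q \<and> f a = -1}"
  have "Q > 0" using assms(1) by simp
  then obtain u where u: "coprime u Q" "f u = -1"
    using exists_coprime_f_minus_1[OF _ assms(2)] by blast
  have fQ: "f (n mod Q) = f n" for n
    by (rule f_cong) (simp only: cong_def mod_mod_cancel[OF assms(2)])
  have "inj_on (\<lambda>a. u * a mod Q) ?R'"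
  proof (rule inj_onI)
    fix m n assume *: "m \<in> ?R'" "n \<in> ?R'" "u * m mod Q = u * n mod Q"
    then have "[u * m = u * n] (mod Q)" by (simp only: cong_def)
    then have "[m = n] (mod Q)" using u(1) cong_mult_lcancel_nat by blast
    with * show "m = n" by (simp add: cong_def)
  qed
  moreover have "(\<lambda>a. u * a mod Q) ` ?R' \<subseteq> ?R"
  proof
    fix b assume "b \<in> (\<lambda>a. u * a mod Q) ` ?R'"
    then obtain a where a: "b = u * a mod Q" "coprime a Q" "f a = -1" by blast
    have "coprime (u * a) Q" using u(1) a(2) by simp
    then have "coprime b Q" unfolding a(1) using \<open>Q > 0\<close> by simp
    moreover have "f b = 1" unfolding a(1) fQ mult using u a by simp
    moreover have "b < Q" unfolding a(1) using \<open>Q > 0\<close> by simp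
    ultimately show "b \<in> ?R" by blast
  qed
  ultimately have "card ?R' \<le> card ?R" by (rule card_inj_on_le) simp
  moreover have "totatives Q \<subseteq> ?R \<union> ?R'"
  proof
    fix a assume a: "a \<in> totatives Q"
    then have "a < Q" "coprime a Q" using assms by (auto simp: totatives_def le_less)
    moreover have "coprime a q" by (rule coprime_divisors[OF dvd_refl assms(2) \<open>coprime a Q\<close>])
    then have "f a \<noteq> 0" by (simp add: nonzero_iff)
    ultimately show "a \<in> ?R \<union> ?R'" using vals[of a] by auto
  qed
  then have "card (totatives Q) \<le> card ?R + card ?R'"
    by (intro order.trans[OF card_mono card_Un_le]) auto
  ultimately show ?thesis by (simp add: totient_def)
qed

text \<open>Averaging over the residue classes \<open>a\<close> modulo \<open>Q\<close> with \<open>f a = 1\<close>.\<close>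
lemma W_le_rough_numbers:
  assumes Q: "Q > 1" "q dvd Q" "real Q \<le> sqrt (y / ln y)" and t: "real Q * (y + 1) \<le> real t"
    and G: "G = {v. 0 < v \<and> v \<le> t \<and> f v = 1 \<and> (\<forall>p. prime p \<and> real p \<le> sqrt (y / ln y) \<longrightarrow> \<not> p dvd v)}"
  shows "real (W y) \<le> 2 * real (card G) / real Q"
proof -
  define z where "z = sqrt (y / ln y)"
  let ?R = "{a. a < Q \<and> coprime a Q \<and> f a = 1}"
  define T where "T a = {n::int. 0 \<le> n \<and> real_of_int n \<le> y \<and>
      (\<forall>p. prime p \<and> real p \<le> z \<and> \<not> p dvd Q \<longrightarrow> \<not> int p dvd int Q * n + int a)}" for a
  have W: "real (W y) \<le> real (card (T a)) * (real (totient Q) / real Q)" for a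
    using W_le_progression[of Q y a] Q unfolding T_def z_def by simp
  have finT: "finite (T a)" for a
    by (rule finite_subset[of _ "{0..\<lfloor>y\<rfloor>}"]) (auto simp: T_def le_floor_iff)
  have finG: "finite G" unfolding G by (rule finite_subset[of _ "{..t}"]) auto
  have "totient Q > 0" using Q by simp
  then have Rpos: "card ?R > 0" using totient_le_card_f_eq_1[OF Q(1,2)] by linarith
  have "(\<Sum>a\<in>?R. card (T a)) = card (SIGMA a:?R. T a)"
    using finT by (intro card_SigmaI[symmetric]) auto
  also have "\<dots> \<le> card G"
  proof (rule card_inj_on_le[OF _ _ finG])
    \<comment> \<open>Quotient and remainder by \<open>Q\<close> recover \<open>n\<close> and
      \<open>a\<close>, so survivors from different classes are distinct elements of
      \<open>G\<close>.\<close>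
    let ?h = "\<lambda>(a, n). nat (int Q * n + int a)"
    show "inj_on ?h (SIGMA a:?R. T a)"
    proof (rule inj_onI, clarsimp)
      fix a n a' n'
      assume *: "a < Q" "a' < Q" "n \<in> T a" "n' \<in> T a'"
        "nat (int Q * n + int a) = nat (int Q * n' + int a')"
      then have "n \<ge> 0" "n' \<ge> 0" by (auto simp: T_def)
      then have eq: "int Q * n + int a = int Q * n' + int a'"
        using * by (simp add: nat_eq_iff)
      have "(int Q * n + int a) mod int Q = int a" "(int Q * n' + int a') mod int Q = int a'"
        using * by simp_all
      with eq have "int a = int a'" by metis
      with eq Q show "a = a' \<and> n = n'" by simp
    qed
    show "?h ` (SIGMA a:?R. T a) \<subseteq> G"
    proof (clarify)
      fix a n assume a: "a < Q" "coprime a Q" "f a = 1" and n: "n \<in> T a"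
      define m where "m = nat n"
      have nm: "n = int m" using n by (auto simp: T_def m_def)
      define v where "v = Q * m + a"
      have vi: "int v = int Q * n + int a" by (simp add: nm v_def)
      then have v: "nat (int Q * n + int a) = v" by (metis nat_int)
      have "a > 0" using a Q by (cases a) auto
      then have "0 < v" by (simp add: v_def)
      moreover have "v \<le> t"
      proof -
        have "real m \<le> y" using n by (auto simp: T_def nm)
        then have "real v \<le> real Q * y + real Q" using a unfolding v_def
          by (simp add: add_mono mult_left_mono less_imp_le)
        then have "real v \<le> real t" using t by (simp add: algebra_simps)
        then show ?thesis by simp
      qed
      moreover have "f v = 1"
      proof -
        obtain k where "Q = q * k" using Q(2) by blast
        then have "v = a + (k * m) * q" by (simp add: v_def)
        then show ?thesis using a by (simp only: f_add_mult)
      qed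
      \<comment> \<open>The set \<open>T a\<close> is not sieved by the primes dividing
        \<open>Q\<close>; they are excluded because \<open>a\<close> is coprime to
        \<open>Q\<close>.\<close>
      moreover have "\<not> p dvd v" if p: "prime p" "real p \<le> z" for p
      proof (cases "p dvd Q")
        case True
        show ?thesis
        proof
          assume "p dvd v"
          then have "p dvd a" using True by (simp add: v_def dvd_add_right_iff)
          then show False using True a(2) p(1) coprime_common_divisor not_prime_unit by blast
        qed
      next
        case False
        then have "\<not> int p dvd int v" using n p unfolding vi T_def by blast
        then show ?thesis by simp
      qed
      ultimately show "nat (int Q * n + int a) \<in> G" unfolding v G z_def[symmetric] by blast
    qed
  qed
  finally have le: "(\<Sum>a\<in>?R. card (T a)) \<le> card G" .
  have "\<exists>a\<in>?R. card ?R * card (T a) \<le> card G"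
  proof (rule ccontr)
    assume "\<not> ?thesis"
    then have "(\<Sum>a\<in>?R. card G) < (\<Sum>a\<in>?R. card ?R * card (T a))"
      using Rpos by (intro sum_strict_mono) (auto simp: not_le card_gt_0_iff)
    also have "\<dots> = card ?R * (\<Sum>a\<in>?R. card (T a))" by (simp add: sum_distrib_left)
    also have "\<dots> \<le> card ?R * card G" using le by (rule mult_left_mono) simp
    finally show False by simp
  qed
  then obtain a where a: "card ?R * card (T a) \<le> card G" by blast
  \<comment> \<open>At least half of the units have value 1, so the totient saved by the greedy
    choice cancels against the number of classes averaged over.\<close>
  have "real (totient Q) \<le> 2 * real (card ?R)"
    using totient_le_card_f_eq_1[OF Q(1,2)] by linarith
  then have "real (card (T a)) * real (totient Q) \<le> real (card (T a)) * (2 * real (card ?R))"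
    by (rule mult_left_mono) simp
  also have "\<dots> = 2 * real (card ?R * card (T a))" by simp
  also have "\<dots> \<le> 2 * real (card G)" using of_nat_mono[OF a, where 'a = real] by linarith
  finally have "real (card (T a)) * real (totient Q) / real Q \<le> 2 * real (card G) / real Q"
    by (rule divide_right_mono) simp
  then show ?thesis using W[of a] by simp
qed

end

section \<open>The choice of scales and the final count of survivors\<close>

context exceptional_zero
begin

text \<open>The constant is 2 * 8 * (1 + 140 + 3650): the factor 2 is from
  \<open>W_le_rough_numbers\<close>, 8 compares \<open>t\<close> with \<open>Q * y\<close>, and the
  bracket bounds the survivors that are 1, prime, or products of two primes.\<close>

lemma W_le_delta:
  assumes big: "1000 * ln (real q) \<le> l" and l: "\<delta> * l\<^sup>2 = ln (real q)" and y: "y = exp l"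
  shows "real (W y) \<le> 60656 * \<delta> * y"
proof -
  have lq: "ln (real q) \<ge> 1" by (rule ln_q_ge_1)
  have l1000: "l \<ge> 1000" using big lq by linarith
  have lny: "ln y = l" by (simp add: y)
  have ypos: "y > 0" by (simp add: y)
  have y1: "y \<ge> 1" using l1000 by (simp add: y)
  have qpos: "real q > 0" using q_pos by simp
  define Y where "Y = nat \<lceil>y\<rceil>"
  have Y: "y \<le> real Y" "real Y \<le> 2 * y" "Y \<ge> 1" using y1 unfolding Y_def by linarith+
  \<comment> \<open>The exponent is 42 + 20: dividing by the unknown \<open>m \<le> q ^ 42\<close>
    leaves at least \<open>q ^ 20 * Y\<close>, enough for a multiple of \<open>q\<close> to fit and
    for \<open>t\<close> to exceed \<open>1 / \<delta>\<close>.\<close>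
  define X where "X = q ^ 62 * Y"
  have X: "X \<ge> q ^ 42"
  proof -
    have "q ^ 42 \<le> q ^ 62" using q_pos by (intro power_increasing) auto
    also have "\<dots> * 1 \<le> X" unfolding X_def using Y by (intro mult_left_mono) auto
    finally show ?thesis by simp
  qed
  have "1 \<le> q ^ 42" using q_pos by simp
  with X have X1: "1 \<le> X" by linarith
  obtain m where m: "m \<in> {0<..q ^ 42}"
    and theta: "(\<Sum>p | prime p \<and> f p = 1 \<and> p \<le> X div m. ln (real p)) \<le> 14 * \<delta> * (real X / real m) * ln (real X)"
    using obtain_sparse_scale[OF X] .
  define t where "t = X div m"
  have t_ge: "q ^ 20 * Y \<le> t"
  proof -
    have "X = (q ^ 20 * Y) * q ^ 42" by (simp add: X_def power_add[symmetric])
    then have "q ^ 20 * Y = X div q ^ 42" using q_pos by simp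
    also have "\<dots> \<le> t" unfolding t_def using m by (intro div_le_mono2) auto
    finally show ?thesis .
  qed
  have "t \<le> X" by (simp add: t_def)
  have t_pos: "t > 0" using t_ge Y q_pos by (smt (verit) gr0I le_zero_eq mult_is_0 not_one_le_zero power_eq_0_iff)
  have Xm: "real X / real m \<le> 2 * real t"
  proof -
    have "X < Suc t * m" using dividend_less_div_times[of m X] m by (simp add: t_def)
    then have "real X \<le> real (Suc t) * real m" by (metis of_nat_le_iff of_nat_mult less_imp_le)
    also have "\<dots> \<le> (2 * real t) * real m" using t_pos by (intro mult_right_mono) auto
    finally show ?thesis using m by (simp add: pos_divide_le_eq)
  qed
  have X_le: "real X \<le> real q ^ 63 * y"
  proof -
    have "real X \<le> real q ^ 62 * (2 * y)" unfolding X_def using Y by (simp add: mult_left_mono)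
    also have "\<dots> \<le> real q ^ 62 * (real q * y)" using q_gt_2 ypos by (intro mult_left_mono mult_right_mono) auto
    also have "\<dots> = real q ^ 63 * y" by (simp add: eval_nat_numeral)
    finally show ?thesis .
  qed
  have t_le: "real t \<le> real q ^ 63 * y" using X_le \<open>t \<le> X\<close> by linarith
  have ln_bound: "ln (real q ^ 63 * y) = 63 * ln (real q) + l"
    using qpos ypos by (simp add: ln_mult ln_realpow lny)
  have lnX: "ln (real X) \<le> 2 * l"
  proof -
    have "real X > 0" using X1 by simp
    then have "ln (real X) \<le> ln (real q ^ 63 * y)" using X_le by simp
    with ln_bound big lq show ?thesis by linarith
  qed

  \<comment> \<open>\<open>Q\<close> is the largest multiple of \<open>q\<close> for which the numbers \<open>Q n + a\<close> stay below the sparse scale \<open>t\<close>.\<close>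
  define K where "K = t div (q * (Y + 1))"
  define Q where "Q = q * K"
  have K: "K \<ge> 1"
  proof -
    have "q * (Y + 1) \<le> q * (2 * Y)" using Y by (intro mult_left_mono) auto
    also have "\<dots> \<le> q * (q * Y)" using q_gt_2 by (intro mult_left_mono mult_right_mono) auto
    also have "\<dots> = q ^ 2 * Y" by (simp add: power2_eq_square)
    also have "\<dots> \<le> q ^ 20 * Y" using q_pos by (intro mult_right_mono power_increasing) auto
    also note t_ge
    finally show ?thesis using q_pos by (simp add: K_def div_greater_zero_iff Suc_le_eq)
  qed
  have Q1: "Q > 1" using K q_gt_2 unfolding Q_def by (metis One_nat_def Suc_1 less_trans mult.right_neutral
      mult_le_mono2 order_less_le_trans lessI)
  have Qt: "Q * (Y + 1) \<le> t"
  proof -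
    have "Q * (Y + 1) = t div (q * (Y + 1)) * (q * (Y + 1))" by (simp only: Q_def K_def mult_ac)
    then show ?thesis by (simp only: div_times_less_eq_dividend)
  qed
  \<comment> \<open>Maximality of \<open>K\<close> costs one factor 2, and
    \<open>Y + 1 \<le> 2 * Y\<close> and \<open>Y \<le> 2 * y\<close> cost one each.\<close>
  have t_Q: "real t \<le> 8 * real Q * y"
  proof -
    have "t < Suc K * (q * (Y + 1))"
      using dividend_less_div_times[of "q * (Y + 1)" t] q_pos by (simp add: K_def)
    also have "\<dots> \<le> (2 * K) * (q * (2 * Y))" using K Y by (intro mult_mono) auto
    also have "\<dots> = 4 * (Q * Y)" by (simp add: Q_def)
    finally have "real t \<le> real (4 * (Q * Y))" by linarith
    also have "\<dots> = 4 * real Q * real Y" by simp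
    also have "\<dots> \<le> 4 * real Q * (2 * y)" using Y by (intro mult_left_mono) auto
    finally show ?thesis by simp
  qed
  have Q_le: "Q \<le> q ^ 62"
  proof -
    have "Q * Y \<le> Q * (Y + 1)" by simp
    also note Qt
    also note \<open>t \<le> X\<close>
    finally have "Q * Y \<le> q ^ 62 * Y" unfolding X_def .
    then show ?thesis using Y by simp
  qed

  define z where "z = sqrt (y / ln y)"
  have z2: "z\<^sup>2 = y / l" using ypos l1000 by (simp add: z_def lny)
  have zpos: "z > 0" using ypos l1000 by (simp add: z_def lny)
  have lnz: "ln z \<ge> 2 / 5 * l"
  proof -
    have "2 * ln z = ln (z\<^sup>2)" using zpos by (simp add: ln_realpow)
    also have "\<dots> = l - ln l" using ypos l1000 by (simp add: z2 ln_div lny)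
    finally have "2 * ln z = l - ln l" .
    moreover have "ln l \<le> l / 5"
    proof -
      have "ln l = 2 * ln (sqrt l)" using l1000 by (simp add: ln_sqrt)
      also have "\<dots> \<le> 2 * sqrt l" using l1000 ln_le_minus_one[of "sqrt l"] by simp
      also have "\<dots> \<le> sqrt l * sqrt l / 5"
      proof -
        have "10 \<le> sqrt l" using l1000 by (intro real_le_rsqrt) simp
        then have "10 * sqrt l \<le> sqrt l * sqrt l" using l1000 by (intro mult_right_mono) auto
        then show ?thesis by simp
      qed
      also have "\<dots> = l / 5" using l1000 by simp
      finally show ?thesis .
    qed
    ultimately show ?thesis by linarith
  qed
  have z1: "z > 1"
  proof -
    have "ln z > 0" using lnz l1000 by linarith
    then show ?thesis using zpos by simp
  qed
  have Qz: "real Q \<le> sqrt (y / ln y)"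
  proof -
    have "ln (real q ^ 62) \<le> ln z" using lnz big lq qpos by (simp add: ln_realpow)
    then have "real q ^ 62 \<le> z" using zpos qpos by simp
    moreover have "real Q \<le> real q ^ 62" using Q_le by (metis of_nat_le_iff of_nat_power)
    ultimately show ?thesis unfolding z_def[symmetric] by linarith
  qed
  \<comment> \<open>The logarithms are at most \<open>l + 63 * l / 1000\<close> on the left and at
    least \<open>6 / 5 * l\<close> on the right, so survivors have at most two prime
    factors.\<close>
  have tz: "real t < z ^ 3"
  proof -
    have "ln (real t) \<le> ln (real q ^ 63 * y)" using t_le t_pos by simp
    also have "\<dots> < ln (z ^ 3)" using ln_bound lnz big lq zpos by (simp add: ln_realpow)
    finally show ?thesis using t_pos zpos by simp
  qed

  define G where "G = {v. 0 < v \<and> v \<le> t \<and> f v = 1 \<and> (\<forall>p. prime p \<and> real p \<le> z \<longrightarrow> \<not> p dvd v)}"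
  let ?P = "{p. prime p \<and> z < real p \<and> f p = 1 \<and> real p \<le> real t}"
  let ?V = "{v. real v \<le> real t \<and> (\<exists>p r. prime p \<and> prime r \<and> z < real p \<and> p \<le> r \<and> v = p * r)}"
  have "G \<subseteq> {1} \<union> ?P \<union> ?V"
  proof
    fix v assume v: "v \<in> G"
    then have "v = 1 \<or> prime v \<or> (\<exists>p r. prime p \<and> prime r \<and> z < real p \<and> p \<le> r \<and> v = p * r)"
      using tz z1 by (intro rough_number_cases) (auto simp: G_def not_le)
    moreover have "z < real v" if "prime v" using v that by (auto simp: G_def not_le)
    ultimately show "v \<in> {1} \<union> ?P \<union> ?V" using v by (auto simp: G_def)
  qed
  \<comment> \<open>The exponent 72 is 63 + 9: \<open>t \<le> q ^ 63 * l * z^2\<close>, and the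
    logarithm \<open>l\<close> lost in the sieving limit is itself at most \<open>q ^ 9\<close> by
    \<open>inverse_delta_le\<close>.\<close>
  define k where "k = nat \<lceil>72 * ln (real q)\<rceil>"
  have k: "72 * ln (real q) \<le> real k" "real k \<le> 73 * ln (real q)"
    using lq unfolding k_def by linarith+
  have t4k: "real t \<le> 4 ^ k * z\<^sup>2"
  proof -
    have "l\<^sup>2 = ln (real q) * (1 / \<delta>)" using l delta_pos by (simp add: field_simps)
    also have "\<dots> \<le> real q * real q ^ 16"
      using inverse_delta_le ln_le_minus_one[OF qpos] lq delta_pos by (intro mult_mono) auto
    also have "\<dots> = real q ^ 17" by (simp add: eval_nat_numeral)
    also have "\<dots> \<le> real q ^ 18" using q_gt_2 by (intro power_increasing) auto
    also have "\<dots> = (real q ^ 9)\<^sup>2" by (simp add: power_mult[symmetric])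
    finally have "l \<le> real q ^ 9" by (rule power2_le_imp_le) simp
    have "real t \<le> real q ^ 63 * y" by (rule t_le)
    also have "y = l * z\<^sup>2" using z2 l1000 by simp
    also have "real q ^ 63 * (l * z\<^sup>2) \<le> real q ^ 63 * (real q ^ 9 * z\<^sup>2)"
      using \<open>l \<le> real q ^ 9\<close> by (intro mult_left_mono mult_right_mono) auto
    also have "\<dots> = real q ^ 72 * z\<^sup>2" by (simp add: power_add[symmetric] mult.assoc[symmetric])
    also have "\<dots> \<le> 4 ^ k * z\<^sup>2"
    proof (intro mult_right_mono)
      have "real q ^ 72 = exp (72 * ln (real q))" using qpos by (simp add: exp_of_nat_mult[of 72, simplified])
      also have "\<dots> \<le> exp (real k)" using k by simp
      also have "\<dots> = exp 1 ^ k" by (simp add: exp_of_nat_mult[symmetric])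
      also have "\<dots> \<le> 4 ^ k" using exp_le by (intro power_mono) auto
      finally show "real q ^ 72 \<le> 4 ^ k" .
    qed simp
    finally show ?thesis .
  qed
  have finP: "finite ?P" by (rule finite_subset[of _ "{..t}"]) auto
  have finV: "finite ?V" and cardV: "real (card ?V) \<le> 8 * real k * real t / (ln z)\<^sup>2"
    using card_semiprimes_le[OF z1 _ t4k] by auto
  have "card G \<le> card ({1} \<union> ?P \<union> ?V)"
    using \<open>G \<subseteq> _\<close> finP finV by (intro card_mono) auto
  also have "\<dots> \<le> 1 + card ?P + card ?V"
    by (intro order.trans[OF card_Un_le] add_mono) (auto intro: order.trans[OF card_Un_le])
  finally have cardG: "real (card G) \<le> 1 + real (card ?P) + real (card ?V)" by linarith
  \<comment> \<open>The factor \<open>ln X \<le> 2 * l\<close> of the sparse scale is cancelled by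
    the weight \<open>ln z \<ge> 2 / 5 * l\<close> of each prime: 14 * 2 * 2 * 5/2 = 140.\<close>
  have "real (card ?P) \<le> 140 * \<delta> * real t"
  proof -
    have "(\<Sum>p | prime p \<and> f p = 1 \<and> real p \<le> real t. ln (real p)) \<le> 14 * \<delta> * (real X / real m) * ln (real X)"
      using theta by (simp add: t_def)
    also have "\<dots> \<le> 14 * \<delta> * (2 * real t) * (2 * l)"
      using Xm lnX delta_pos l1000 X1 by (intro mult_mono mult_left_mono) (auto intro!: ln_ge_zero)
    finally have "real (card ?P) \<le> 14 * \<delta> * (2 * real t) * (2 * l) / ln z"
      by (intro card_primes_between_le z1) auto
    also have "\<dots> \<le> 14 * \<delta> * (2 * real t) * (2 * l) / (2 / 5 * l)"
      using lnz l1000 delta_pos by (intro divide_left_mono) auto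
    also have "\<dots> = 140 * \<delta> * real t" using l1000 by (simp add: field_simps)
    finally show ?thesis .
  qed
  \<comment> \<open>The relation between \<open>y\<close> and \<delta> is used here:
    \<open>ln q / l^2\<close> equals \<delta>, with constant 8 * 73 * 25/4.\<close>
  moreover have "real (card ?V) \<le> 3650 * \<delta> * real t"
  proof -
    note cardV
    also have "8 * real k * real t / (ln z)\<^sup>2 \<le> 8 * (73 * ln (real q)) * real t / (2 / 5 * l)\<^sup>2"
      using k lnz l1000 by (intro frac_le mult_mono power_mono) auto
    also have "\<dots> = 3650 * (ln (real q) / l\<^sup>2) * real t" by (simp add: power2_eq_square field_simps)
    also have "ln (real q) / l\<^sup>2 = \<delta>" using l[symmetric] l1000 by simp
    finally show ?thesis .
  qed
  \<comment> \<open>This absorbs the survivor 1 into the main bound.\<close>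
  moreover have "1 \<le> \<delta> * real t"
  proof -
    have "1 / \<delta> \<le> real q ^ 16" by (rule inverse_delta_le)
    also have "\<dots> \<le> real q ^ 20" using q_gt_2 by (intro power_increasing) auto
    also have "\<dots> \<le> real (q ^ 20 * Y)"
      using mult_left_mono[of 1 "real Y" "real q ^ 20"] Y by simp
    also have "\<dots> \<le> real t" using t_ge by (simp only: of_nat_le_iff)
    finally show ?thesis using delta_pos by (simp add: field_simps)
  qed
  ultimately have "real (card G) \<le> 3791 * \<delta> * real t" using cardG by (simp add: algebra_simps)
  also have "\<dots> \<le> 3791 * \<delta> * (8 * real Q * y)" using t_Q delta_pos by (intro mult_left_mono) auto
  finally have G_le: "real (card G) \<le> 30328 * \<delta> * y * real Q" by (simp add: mult_ac)
  have "real (W y) \<le> 2 * real (card G) / real Q"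
  proof (rule W_le_rough_numbers[OF Q1 _ Qz])
    show "q dvd Q" by (simp add: Q_def)
    have "real Q * (y + 1) \<le> real Q * (real Y + 1)" using Y by (intro mult_left_mono) auto
    also have "\<dots> = real (Q * (Y + 1))" by (simp add: algebra_simps)
    also have "\<dots> \<le> real t" using Qt by (simp only: of_nat_le_iff)
    finally show "real Q * (y + 1) \<le> real t" .
  qed (simp add: G_def z_def)
  also have "\<dots> \<le> 2 * (30328 * \<delta> * y * real Q) / real Q"
    using G_le by (intro divide_right_mono mult_left_mono) auto
  also have "\<dots> = 60656 * \<delta> * y" using Q1 by simp
  finally show ?thesis .
qed

end

theorem theorem9p1:
  "\<exists>c>0. \<exists>A>0. \<forall>(q::nat) (chi :: int \<Rightarrow> complex) (\<delta>::real) (y::real).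
     q \<ge> 1 \<longrightarrow>
     dirichlet_character q chi \<longrightarrow> real_character chi \<longrightarrow>
     0 < \<delta> \<longrightarrow> \<delta> \<le> c / ln (real q) \<longrightarrow>
     dirichlet_L q chi (complex_of_real (1 - \<delta>)) = 0 \<longrightarrow>
     y = exp (sqrt (ln (real q) / \<delta>)) \<longrightarrow>
     real (W y) \<le> A * \<delta> * y"
proof (rule exI[of _ "1 / 10 ^ 6"], rule conjI, simp, rule exI[of _ 60656], rule conjI, simp, intro allI impI)
  fix q :: nat and chi :: "int \<Rightarrow> complex" and \<delta> y :: real
  assume q: "q \<ge> 1" and chi: "dirichlet_character q chi" "real_character chi"
    and \<delta>: "0 < \<delta>" "\<delta> \<le> 1 / 10 ^ 6 / ln (real q)"
    and zero: "dirichlet_L q chi (complex_of_real (1 - \<delta>)) = 0"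
    and y: "y = exp (sqrt (ln (real q) / \<delta>))"
  \<comment> \<open>For \<open>q = 1\<close> the upper bound for \<delta> is a division by
    \<open>ln 1 = 0\<close>, hence 0, contradicting positivity.\<close>
  have "q \<noteq> 1" using \<delta> by auto
  with q have q2: "real q \<ge> 2" by linarith
  have ln2: "ln (real q) \<ge> 1 / 2"
  proof -
    have "1 / 2 \<le> ln (2::real)" using ln_le_minus_one[of "1 / 2 :: real"] by (simp add: ln_div)
    also have "\<dots> \<le> ln (real q)" using q2 by simp
    finally show ?thesis .
  qed
  have \<delta>l: "\<delta> * ln (real q) \<le> 1 / 10 ^ 6" using \<delta> ln2 by (simp add: field_simps)
  have "\<delta> * (1 / 2) \<le> \<delta> * ln (real q)" using ln2 \<delta> by (intro mult_left_mono) auto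
  then have \<delta>1: "\<delta> < 1" using \<delta>l by simp
  have np: "\<not> principal_character q chi"
    using dirichlet_L_principal_nonzero[OF chi(1) _ \<delta>(1) \<delta>1] zero by blast
  define f where "f n = Re (chi (int n))" for n
  interpret real_char q f
    unfolding f_def using real_char_of_dirichlet_character(1)[OF chi np] .
  have "complex_of_real (L (1 - \<delta>)) = 0"
    using dirichlet_L_eq_L[OF _ np, of "1 - \<delta>"] real_char_of_dirichlet_character(2)[OF chi np] \<delta>1 zero
    by (simp add: f_def)
  then have "L (1 - \<delta>) = 0" by simp
  then interpret exceptional_zero q f \<delta>
    using \<delta>(1) \<delta>l by unfold_locales auto
  show "real (W y) \<le> 60656 * \<delta> * y"
  proof (rule W_le_delta[OF _ _ y])
    show "\<delta> * (sqrt (ln (real q) / \<delta>))\<^sup>2 = ln (real q)" using \<delta> ln2 by simp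
    \<comment> \<open>The constant \<open>1 / 10 ^ 6\<close> is the inverse square of the factor
      1000 demanded here; it also far exceeds what the factor 42 of \<open>exceptional_zero\<close>
      demands.\<close>
    show "1000 * ln (real q) \<le> sqrt (ln (real q) / \<delta>)"
    proof (rule real_le_rsqrt)
      have "(1000 * ln (real q))\<^sup>2 * \<delta> = 10 ^ 6 * (\<delta> * ln (real q)) * ln (real q)"
        by (simp add: power2_eq_square)
      also have "\<dots> \<le> 10 ^ 6 * (1 / 10 ^ 6) * ln (real q)"
        using \<delta>l ln2 by (intro mult_left_mono mult_right_mono) auto
      finally show "(1000 * ln (real q))\<^sup>2 \<le> ln (real q) / \<delta>"
        using \<delta> by (simp add: pos_le_divide_eq)
    qed
  qed
qed

end
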